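(* Consider a controlled Markov chain with state space $\mathbb{X}=\mathbb{R}^n$, compact action space $\mathbb{U}$ with admissible action set $\mathbb{U}(x)=\mathbb{U}$ for all $x$, and transition kernel $\mathcal{T}(dy|x,u)$. Suppose: (i) for every stationary policy $\gamma\in\Gamma_S$ there exists a unique invariant probability measure $\pi_\gamma$; (ii) there is a reference measure $\psi$ on $\mathbb{X}$ such that each $\mathcal{T}(dy|x,u)$, $(x,u)\in\mathbb{X}\times\mathbb{U}$, has a density $f_{x,u}(y)$ with respect to $\psi$, and the family $\{f_{x,u}: x\in\mathbb{X},u\in\mathbb{U}\}$ is uniformly bounded and equicontinuous; (iii) either (a) $\mathcal{T}$ is weakly continuous (the map $(x,u)\mapsto\int f(z)\mathcal{T}(dz|x,u)$ is continuous for every $f\in C_b(\mathbb{X})$) and the set $\mathcal{G}$ of invariant occupation measures is weakly compact, or (b) for every $x\in\mathbb{X}$ the map $u\mapsto\int f(z)\mathcal{T}(dz|x,u)$ is continuous for every bounded measurable $f$, and there is a finite measure $\nu$ with $\mathcal{T}(dy|x,u)\le\nu(dy)$ for all $x\in\mathbb{X}$, $u\in\mathbb{U}$. Then, endowing $\Gamma_S$ with the Young topology at input measure $\psi$, the map $\gamma\mapsto\pi_\gamma$ is continuous both with respect to weak convergence and with respect to total variation on $\mathcal{P}(\mathbb{X})$.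
   Context: A stationary policy $\gamma\in\Gamma_S$ is a stochastic kernel $\gamma(du|x)$ from $\mathbb{X}$ to $\mathbb{U}$; under it the state process is Markov with kernel $\mathcal{T}^\gamma(A|x)=\int_{\mathbb{U}}\mathcal{T}(A|x,u)\gamma(du|x)$. An invariant probability measure for $\gamma$ is $\pi\in\mathcal{P}(\mathbb{X})$ with $\pi(A)=\int\mathcal{T}^\gamma(A|x)\pi(dx)$ for all Borel $A$. The set of invariant occupation measures is $\mathcal{G}=\{\mu\in\mathcal{P}(\mathbb{X}\times\mathbb{U}): \mu(B\times\mathbb{U})=\int\mu(dx,du)\mathcal{T}(B|x,u)\ \forall B\in\mathcal{B}(\mathbb{X})\}$. Young topology at input $\psi$: $\gamma_n\to\gamma$ if for every continuous bounded $g:\mathbb{X}\times\mathbb{U}\to\mathbb{R}$, $\int\psi(dx)\int\gamma_n(du|x)g(x,u)\to\int\psi(dx)\int\gamma(du|x)g(x,u)$. *)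

theory Defs
  imports "HOL-Probability.Probability"
begin

definition markov_kernel :: "('x::topological_space \<Rightarrow> 'u::topological_space \<Rightarrow> 'x measure) \<Rightarrow> bool" where
  "markov_kernel T \<longleftrightarrow>
     (\<forall>x u. prob_space (T x u) \<and> sets (T x u) = sets borel) \<and>
     (\<lambda>(x,u). T x u) \<in> borel \<rightarrow>\<^sub>M subprob_algebra borel"

definition stationary_policy :: "('x::topological_space \<Rightarrow> 'u::topological_space measure) \<Rightarrow> bool" where
  "stationary_policy \<gamma> \<longleftrightarrow>
     (\<forall>x. prob_space (\<gamma> x) \<and> sets (\<gamma> x) = sets borel) \<and>
     \<gamma> \<in> borel \<rightarrow>\<^sub>M subprob_algebra borel"

definition invariant_prob ::
  "('x::topological_space \<Rightarrow> 'u::topological_space \<Rightarrow> 'x measure) \<Rightarrow> ('x \<Rightarrow> 'u measure) \<Rightarrow> 'x measure \<Rightarrow> bool" where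
  "invariant_prob T \<gamma> \<pi> \<longleftrightarrow>
     prob_space \<pi> \<and> sets \<pi> = sets borel \<and>
     (\<forall>A\<in>sets borel. emeasure \<pi> A = (\<integral>\<^sup>+ x. (\<integral>\<^sup>+ u. emeasure (T x u) A \<partial>\<gamma> x) \<partial>\<pi>))"

definition occupation_measures ::
  "('x::topological_space \<Rightarrow> 'u::topological_space \<Rightarrow> 'x measure) \<Rightarrow> ('x \<times> 'u) measure set" where
  "occupation_measures T =
     {\<mu>. prob_space \<mu> \<and> sets \<mu> = sets (borel :: ('x \<times> 'u) measure) \<and>
          (\<forall>B\<in>sets (borel :: 'x measure).
             emeasure \<mu> (B \<times> UNIV) = (\<integral>\<^sup>+ p. emeasure (T (fst p) (snd p)) B \<partial>\<mu>))}"

definition weak_conv_meas :: "(nat \<Rightarrow> 'a::topological_space measure) \<Rightarrow> 'a measure \<Rightarrow> bool" where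
  "weak_conv_meas \<mu>s \<mu> \<longleftrightarrow>
     (\<forall>g :: 'a \<Rightarrow> real. continuous_on UNIV g \<and> bounded (range g) \<longrightarrow>
        (\<lambda>n. \<integral>x. g x \<partial>\<mu>s n) \<longlonglongrightarrow> (\<integral>x. g x \<partial>\<mu>))"

definition weakly_compact_meas :: "'a::topological_space measure set \<Rightarrow> bool" where
  "weakly_compact_meas M \<longleftrightarrow>
     (\<forall>\<mu>s :: nat \<Rightarrow> 'a measure. (\<forall>n. \<mu>s n \<in> M) \<longrightarrow>
        (\<exists>(r :: nat \<Rightarrow> nat) \<mu>. strict_mono r \<and> \<mu> \<in> M \<and> weak_conv_meas (\<mu>s \<circ> r) \<mu>))"

definition tv_conv_meas :: "(nat \<Rightarrow> 'a::topological_space measure) \<Rightarrow> 'a measure \<Rightarrow> bool" where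
  "tv_conv_meas \<mu>s \<mu> \<longleftrightarrow>
     (\<lambda>n. SUP A\<in>sets (borel :: 'a measure). \<bar>measure (\<mu>s n) A - measure \<mu> A\<bar>) \<longlonglongrightarrow> 0"

definition young_conv ::
  "'x::topological_space measure \<Rightarrow> (nat \<Rightarrow> 'x \<Rightarrow> 'u::topological_space measure) \<Rightarrow> ('x \<Rightarrow> 'u measure) \<Rightarrow> bool" where
  "young_conv \<psi> \<gamma>s \<gamma> \<longleftrightarrow>
     (\<forall>g :: 'x \<times> 'u \<Rightarrow> real. continuous_on UNIV g \<and> bounded (range g) \<longrightarrow>
        (\<lambda>n. \<integral>x. (\<integral>u. g (x, u) \<partial>\<gamma>s n x) \<partial>\<psi>) \<longlonglongrightarrow> (\<integral>x. (\<integral>u. g (x, u) \<partial>\<gamma> x) \<partial>\<psi>))"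

end

theory Submission
  imports Defs "HOL-Complex_Analysis.Great_Picard"
begin

text \<open>
  Averaging the densities \<open>f\<^sub>x\<^sub>,\<^sub>u\<close> over the occupation measure of a policy shows that every \<open>\<pi>\<^sub>\<gamma>\<close> has a
  density \<open>h\<^sub>\<gamma>\<close> with respect to \<open>\<psi>\<close>, and that these densities inherit the uniform bound and the
  equicontinuity, at least on the support of \<open>\<psi>\<close>. Along any subsequence, a diagonal argument yields
  pointwise convergence of a further subsequence to some \<open>h\<close>, hence convergence in \<open>L\<^sup>1(\<psi>)\<close>, as \<open>\<psi>\<close> is
  finite. For \<open>c\<close> bounded and continuous, the integrand \<open>h(x) \<integral> c dT(x,u)\<close> is measurable in \<open>x\<close> and
  continuous in \<open>u\<close>; Young convergence extends to such integrands, so the invariance equation passes to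
  the limit and \<open>h\<close> is the density of an invariant probability for \<open>\<gamma>\<close>. By uniqueness \<open>h = h\<^sub>\<gamma>\<close> almost
  everywhere, so the densities converge in \<open>L\<^sup>1(\<psi>)\<close>, which gives both modes of convergence.
\<close>

text \<open>The obstacle is that two objects move at once in the invariance equation: the policy
  inside the integral and the invariant measure outside. Weak convergence of the invariant measures
  would not separate them, because the averaged integrand need not be continuous in the state.
  Convergence of the densities in L^1(\<psi>) does: the inner averages are bounded by 1 whatever the
  policy, so the outer measure may be replaced by its limit with an error uniform over policies.
  What then remains moving is the policy alone, integrated against \<psi>, which is exactly the
  input measure of the Young topology; the limit density has become a weight in the integrand.

  The restriction to the support of \<psi> has a measure-theoretic origin. The densities are given
  separately for each \<open>(x, u)\<close>, while averaging them over state-action pairs and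
  applying Tonelli asks for joint measurability. They are therefore multiplied by the indicator of
  the support, which leaves every kernel measure unchanged but may break continuity at the boundary
  of the support, so equicontinuity is stated relative to that set.\<close>

section \<open>Continuous test functions, interchange of limits, partitions of unity\<close>

lemma closed_indicator_limit:
  fixes F :: "'a::metric_space set"
  assumes "closed F"
  shows "\<exists>c::nat \<Rightarrow> 'a \<Rightarrow> real. (\<forall>k. continuous_on UNIV (c k)) \<and> (\<forall>k x. 0 \<le> c k x \<and> c k x \<le> 1) \<and>
           (\<forall>x. (\<lambda>k. c k x) \<longlonglongrightarrow> indicator F x)"
proof (cases "F = {}")
  \<comment> \<open>By convention the distance to the empty set is 0, so the powers used below would
    tend to 1 instead of 0.\<close>
  case True
  then show ?thesis
    by (intro exI[of _ "\<lambda>_ _. 0"]) auto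
next
  case False
  let ?c = "\<lambda>(k::nat) x. (1 / (1 + infdist x F)) ^ k"
  have pos: "0 < 1 + infdist x F" for x
    using infdist_nonneg[of x F] by linarith
  have "continuous_on UNIV (?c k)" for k
    using pos by (intro continuous_intros) (auto simp: less_imp_neq[symmetric])
  moreover have "0 \<le> ?c k x \<and> ?c k x \<le> 1" for k x
    using infdist_nonneg[of x F] by (auto intro!: power_le_one)
  moreover have "(\<lambda>k. ?c k x) \<longlonglongrightarrow> indicator F x" for x
  proof (cases "x \<in> F")
    case True
    then show ?thesis by simp
  next
    case out: False
    then have "0 < infdist x F"
      using assms False infdist_nonneg[of x F] by (metis in_closed_iff_infdist_zero order_le_less)
    then show ?thesis
      using out by (auto intro!: LIMSEQ_power_zero)
  qed
  ultimately show ?thesis by (intro exI[of _ ?c]) blast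
qed

text \<open>Closed sets form an intersection-stable generator of the Borel sets that contains the
  whole space, and their indicators are bounded limits of continuous functions with values in
  [0,1].\<close>

lemma finite_measure_eqI_continuous:
  fixes M N :: "'a::metric_space measure"
  assumes M: "finite_measure M" "sets M = sets borel"
    and N: "finite_measure N" "sets N = sets borel"
    and eq: "\<And>c :: 'a \<Rightarrow> real. continuous_on UNIV c \<Longrightarrow> (\<And>x. 0 \<le> c x \<and> c x \<le> 1) \<Longrightarrow>
               (\<integral>x. c x \<partial>M) = (\<integral>x. c x \<partial>N)"
  shows "M = N"
proof (rule measure_eqI_generator_eq[where E="Collect closed" and \<Omega>=UNIV and A="\<lambda>_. UNIV"])
  interpret M: finite_measure M by fact
  interpret N: finite_measure N by fact
  fix F :: "'a set" assume "F \<in> Collect closed"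
  then have F: "closed F" by simp
  from closed_indicator_limit[OF this] obtain c :: "nat \<Rightarrow> 'a \<Rightarrow> real"
    where c: "\<And>k. continuous_on UNIV (c k)" "\<And>k x. 0 \<le> c k x \<and> c k x \<le> 1"
      "\<And>x. (\<lambda>k. c k x) \<longlonglongrightarrow> indicator F x" by blast
  have lim: "(\<lambda>k. \<integral>x. c k x \<partial>K) \<longlonglongrightarrow> measure K F"
    if "finite_measure K" and K: "sets K = sets borel" for K :: "'a measure"
  proof -
    interpret K: finite_measure K by fact
    have "(\<lambda>k. \<integral>x. c k x \<partial>K) \<longlonglongrightarrow> (\<integral>x. indicator F x \<partial>K)"
    proof (rule integral_dominated_convergence[where w="\<lambda>_. 1"])
      show "c k \<in> borel_measurable K" for k
        using borel_measurable_continuous_onI[OF c(1)] K by (simp cong: measurable_cong_sets)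
    qed (use c F K borel_measurable_indicator[of F K] in auto)
    then show ?thesis
      using F K by (simp add: sets_eq_imp_space_eq)
  qed
  have "measure M F = measure N F"
    using lim[OF M] lim[OF N] eq[OF c(1,2)] by (simp add: LIMSEQ_unique)
  then show "emeasure M F = emeasure N F"
    by (simp add: M.emeasure_eq_measure N.emeasure_eq_measure)
next
  show "sets M = sigma_sets UNIV (Collect closed)" "sets N = sigma_sets UNIV (Collect closed)"
    using M N by (auto simp: borel_eq_closed)
  show "emeasure M UNIV \<noteq> \<infinity>" 
    using finite_measure.emeasure_finite[OF M(1)] by simp
qed (auto simp: Int_stable_def)

text \<open>Interchange of limits: the error \<open>e k\<close> does not depend on \<open>n\<close>,
  so one sufficiently good \<open>k\<close> serves the whole sequence and its limit.\<close>

lemma LIMSEQ_uniform_approx: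
  fixes Y :: "nat \<Rightarrow> real"
  assumes X: "\<And>k::nat. (\<lambda>n. X k n) \<longlonglongrightarrow> L k"
    and bound: "\<And>k n. \<bar>X k n - Y n\<bar> \<le> e k" "\<And>k. \<bar>L k - L'\<bar> \<le> e k"
    and e: "e \<longlonglongrightarrow> 0"
  shows "Y \<longlonglongrightarrow> L'"
proof (rule LIMSEQ_I)
  fix r :: real assume "0 < r"
  then obtain k where ek: "\<bar>e k\<bar> < r / 3"
    using LIMSEQ_D[OF e, of "r/3"] by auto
  obtain n0 where n0: "\<And>n. n \<ge> n0 \<Longrightarrow> \<bar>X k n - L k\<bar> < r / 3"
    using LIMSEQ_D[OF X, of "r/3" k] \<open>0 < r\<close> by auto
  have "norm (Y n - L') < r" if "n \<ge> n0" for n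
  proof -
    have "\<bar>X k n - L k\<bar> < r / 3" using n0 that by blast
    then show ?thesis
      using bound(1)[of k n] bound(2)[of k] ek unfolding real_norm_def by linarith
  qed
  then show "\<exists>n0. \<forall>n\<ge>n0. norm (Y n - L') < r" by blast
qed

lemma integrable_mult_bounded:
  fixes b p :: "'a \<Rightarrow> real"
  assumes b: "integrable M b" and p: "p \<in> borel_measurable M" "\<And>x. \<bar>p x\<bar> \<le> C"
  shows "integrable M (\<lambda>x. b x * p x)"
proof (rule Bochner_Integration.integrable_bound)
  show "integrable M (\<lambda>x. C * b x)" using b by simp
  show "AE x in M. norm (b x * p x) \<le> norm (C * b x)"
  proof (rule AE_I2)
    fix x
    have "\<bar>p x\<bar> * \<bar>b x\<bar> \<le> \<bar>C\<bar> * \<bar>b x\<bar>"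
      using p(2)[of x] by (intro mult_right_mono) auto
    then show "norm (b x * p x) \<le> norm (C * b x)" by (simp add: abs_mult mult.commute)
  qed
qed (use b p in auto)

text \<open>The uniform bound \<open>C\<close> on the \<open>q n\<close> turns an L^1 error in the
  weight into an error uniform in \<open>n\<close>. Thus the weights for which convergence holds are
  closed in L^1.\<close>

lemma LIMSEQ_integral_weights_approx:
  fixes \<psi> :: "'a measure" and q :: "nat \<Rightarrow> 'a \<Rightarrow> real"
  assumes q: "\<And>n. q n \<in> borel_measurable \<psi>" "\<And>n x. \<bar>q n x\<bar> \<le> C"
    and q0: "q0 \<in> borel_measurable \<psi>" "\<And>x. \<bar>q0 x\<bar> \<le> C"
    and a: "integrable \<psi> a" "\<And>k::nat. integrable \<psi> (s k)"
    and lim: "(\<lambda>k. \<integral>x. \<bar>s k x - a x\<bar> \<partial>\<psi>) \<longlonglongrightarrow> 0"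
    and s: "\<And>k. (\<lambda>n. \<integral>x. s k x * q n x \<partial>\<psi>) \<longlonglongrightarrow> (\<integral>x. s k x * q0 x \<partial>\<psi>)"
  shows "(\<lambda>n. \<integral>x. a x * q n x \<partial>\<psi>) \<longlonglongrightarrow> (\<integral>x. a x * q0 x \<partial>\<psi>)"
proof (rule LIMSEQ_uniform_approx[OF s])
  have *: "\<bar>(\<integral>x. s k x * p x \<partial>\<psi>) - (\<integral>x. a x * p x \<partial>\<psi>)\<bar> \<le> C * (\<integral>x. \<bar>s k x - a x\<bar> \<partial>\<psi>)"
    if p: "p \<in> borel_measurable \<psi>" "\<And>x. \<bar>p x\<bar> \<le> C" for p k
  proof -
    note int = integrable_mult_bounded[OF _ p]
    have "(\<integral>x. s k x * p x \<partial>\<psi>) - (\<integral>x. a x * p x \<partial>\<psi>) = (\<integral>x. (s k x - a x) * p x \<partial>\<psi>)"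
      using int[OF a(1)] int[OF a(2)] by (simp add: left_diff_distrib)
    also have "\<bar>\<dots>\<bar> \<le> (\<integral>x. \<bar>(s k x - a x) * p x\<bar> \<partial>\<psi>)"
      by (rule integral_abs_bound)
    also have "\<dots> \<le> (\<integral>x. C * \<bar>s k x - a x\<bar> \<partial>\<psi>)"
    proof (rule integral_mono)
      show "integrable \<psi> (\<lambda>x. \<bar>(s k x - a x) * p x\<bar>)"
        using int[of "\<lambda>x. s k x - a x"] a by auto
      show "integrable \<psi> (\<lambda>x. C * \<bar>s k x - a x\<bar>)"
        using a by auto
      show "\<bar>(s k x - a x) * p x\<bar> \<le> C * \<bar>s k x - a x\<bar>" for x
        using mult_right_mono[OF p(2)[of x], of "\<bar>s k x - a x\<bar>"] by (simp add: abs_mult mult.commute)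
    qed
    finally show ?thesis by simp
  qed
  show "\<bar>(\<integral>x. s k x * q n x \<partial>\<psi>) - (\<integral>x. a x * q n x \<partial>\<psi>)\<bar> \<le> C * (\<integral>x. \<bar>s k x - a x\<bar> \<partial>\<psi>)" for k n
    by (rule *[OF q])
  show "\<bar>(\<integral>x. s k x * q0 x \<partial>\<psi>) - (\<integral>x. a x * q0 x \<partial>\<psi>)\<bar> \<le> C * (\<integral>x. \<bar>s k x - a x\<bar> \<partial>\<psi>)" for k
    by (rule *[OF q0])
  show "(\<lambda>k. C * (\<integral>x. \<bar>s k x - a x\<bar> \<partial>\<psi>)) \<longlonglongrightarrow> 0"
    using tendsto_mult_left[OF lim, of C] by simp
qed

text \<open>Weak-star convergence in L^\<infinity> can be tested on a dense part of L^1. The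
  admissible weights are stable under sums, scaling and dominated limits; they contain the
  indicators of closed sets, hence by the pi-lambda theorem those of all Borel sets, hence all
  integrable functions.\<close>

lemma LIMSEQ_integral_weights:
  fixes \<psi> :: "'a::metric_space measure" and q :: "nat \<Rightarrow> 'a \<Rightarrow> real"
  assumes \<psi>: "finite_measure \<psi>" "sets \<psi> = sets borel"
    and q: "\<And>n. q n \<in> borel_measurable \<psi>" "\<And>n x. \<bar>q n x\<bar> \<le> C"
    and q0: "q0 \<in> borel_measurable \<psi>" "\<And>x. \<bar>q0 x\<bar> \<le> C"
    and conv: "\<And>c :: 'a \<Rightarrow> real. continuous_on UNIV c \<Longrightarrow> (\<And>x. 0 \<le> c x \<and> c x \<le> 1) \<Longrightarrow>
               (\<lambda>n. \<integral>x. c x * q n x \<partial>\<psi>) \<longlonglongrightarrow> (\<integral>x. c x * q0 x \<partial>\<psi>)"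
    and a: "integrable \<psi> a"
  shows "(\<lambda>n. \<integral>x. a x * q n x \<partial>\<psi>) \<longlonglongrightarrow> (\<integral>x. a x * q0 x \<partial>\<psi>)"
proof -
  interpret finite_measure \<psi> by fact
  have sp: "space \<psi> = UNIV" using \<psi> by (simp add: sets_eq_imp_space_eq)
  let ?P = "\<lambda>a. (\<lambda>n. \<integral>x. a x * q n x \<partial>\<psi>) \<longlonglongrightarrow> (\<integral>x. a x * q0 x \<partial>\<psi>)"
  have approx: "?P b" if "integrable \<psi> b" "\<And>k::nat. integrable \<psi> (s k)" "\<And>x. (\<lambda>k. s k x) \<longlonglongrightarrow> b x"
      "integrable \<psi> w" "\<And>k x. \<bar>s k x\<bar> \<le> w x" "\<And>k. ?P (s k)" for b s w
  proof (rule LIMSEQ_integral_weights_approx[OF q q0 that(1,2) _ that(6)])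
    have "(\<lambda>k. \<integral>x. \<bar>s k x - b x\<bar> \<partial>\<psi>) \<longlonglongrightarrow> (\<integral>x. 0 \<partial>\<psi>)"
    proof (rule integral_dominated_convergence[where w="\<lambda>x. w x + \<bar>b x\<bar>"])
      show "AE x in \<psi>. (\<lambda>k. \<bar>s k x - b x\<bar>) \<longlonglongrightarrow> 0"
        by (rule AE_I2, rule tendsto_rabs_zero, rule LIM_zero[OF that(3)])
      show "AE x in \<psi>. norm \<bar>s k x - b x\<bar> \<le> w x + \<bar>b x\<bar>" for k
      proof (rule AE_I2)
        show "norm \<bar>s k x - b x\<bar> \<le> w x + \<bar>b x\<bar>" for x
          using that(5)[of k x] by (smt (verit) real_norm_def)
      qed
    qed (use that in auto)
    then show "(\<lambda>k. \<integral>x. \<bar>s k x - b x\<bar> \<partial>\<psi>) \<longlonglongrightarrow> 0" by simp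
  qed
  have addP: "?P (\<lambda>x. b x + b' x)" if "integrable \<psi> b" "?P b" "integrable \<psi> b'" "?P b'" for b b'
    using tendsto_add[OF that(2,4)] integrable_mult_bounded[OF that(1) q] integrable_mult_bounded[OF that(1) q0]
      integrable_mult_bounded[OF that(3) q] integrable_mult_bounded[OF that(3) q0]
    by (simp add: distrib_right)
  have scale: "?P (\<lambda>x. b x * r)" if "?P b" for b r
    using tendsto_mult_left[OF that, of r] by (simp add: ac_simps)
  have ind: "?P (indicator A)" if "A \<in> sets \<psi>" for A
  proof -
    have "A \<in> sigma_sets UNIV (Collect closed)"
      using that \<psi> by (simp add: borel_eq_closed)
    then show ?thesis
    proof (induction rule: sigma_sets_induct_disjoint[rotated 2, consumes 1, case_names basic empty compl union closed_pow int])
      case (basic F)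
      then have F: "closed F" by simp
      from closed_indicator_limit[OF this] obtain c :: "nat \<Rightarrow> 'a \<Rightarrow> real"
        where c: "\<And>k. continuous_on UNIV (c k)" "\<And>k x. 0 \<le> c k x \<and> c k x \<le> 1"
          "\<And>x. (\<lambda>k. c k x) \<longlonglongrightarrow> indicator F x" by blast
      have m: "c k \<in> borel_measurable \<psi>" for k
        using borel_measurable_continuous_onI[OF c(1)] \<psi> by (simp cong: measurable_cong_sets)
      show ?case
      proof (rule approx[of _ c "\<lambda>_. 1"])
        show "integrable \<psi> (c k)" for k
          by (rule integrable_const_bound[of _ 1]) (use m c in auto)
        show "?P (c k)" for k by (rule conv[OF c(1,2)])
      qed (use c F \<psi> borel_measurable_indicator[of F \<psi>] in \<open>auto intro: integrable_const_bound[of _ 1]\<close>)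
    next
      case empty
      show ?case by simp
    next
      case (compl A)
      have A: "A \<in> sets \<psi>" using compl \<psi> by (simp add: borel_eq_closed)
      have one: "?P (\<lambda>_. 1)" using conv[of "\<lambda>_. 1"] by simp
      have "?P (\<lambda>x. 1 + indicator A x * (-1))"
        by (rule addP[OF _ one _ scale[OF compl.IH]]) (use A in \<open>auto intro!: integrable_const_bound[of _ 1]\<close>)
      moreover have "indicator (UNIV - A) x = 1 + indicator A x * (-1 :: real)" for x
        by (auto simp: indicator_def)
      ultimately show ?case by (simp only:)
    next
      case (union A)
      have A: "A i \<in> sets \<psi>" for i using union \<psi> by (auto simp: borel_eq_closed)
      have fin: "?P (\<lambda>x. \<Sum>i<k. indicator (A i) x)" for k :: nat
      proof (induction k)
        case (Suc k)
        show ?case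
          unfolding sum.lessThan_Suc
        proof (rule addP[OF _ Suc _ union.IH])
          show "integrable \<psi> (indicator (A k) :: 'a \<Rightarrow> real)" for k
            using A by (auto intro!: integrable_const_bound[of _ 1])
          then show "integrable \<psi> (\<lambda>x. \<Sum>i<k. indicator (A i) x :: real)"
            by (rule Bochner_Integration.integrable_sum)
        qed
      qed simp
      \<comment> \<open>Disjointness keeps the partial sums below 1, so the constant 1 dominates
        them.\<close>
      have sum_eq: "(\<Sum>i<k. indicator (A i) x) = (indicator (\<Union>i<k. A i) x :: real)" for k x
        by (rule indicator_UN_disjoint[symmetric, OF _ disjoint_family_on_mono[OF subset_UNIV union(1)]]) simp
      show ?case
      proof (rule approx[of _ "\<lambda>k x. \<Sum>i<k. indicator (A i) x" "\<lambda>_. 1"])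
        show "(\<lambda>k. \<Sum>i<k. indicator (A i) x :: real) \<longlonglongrightarrow> indicator (\<Union> (range A)) x" for x
          unfolding sum_eq by (rule LIMSEQ_indicator_UN)
        show "\<bar>\<Sum>i<k. indicator (A i) x\<bar> \<le> (1::real)" for k x
          unfolding sum_eq by (simp add: indicator_def)
        show "?P (\<lambda>x. \<Sum>i<k. indicator (A i) x)" for k by (rule fin)
        show "integrable \<psi> (indicator (\<Union>(range A)) :: 'a \<Rightarrow> real)"
          using A by (intro integrable_const_bound[of _ 1] borel_measurable_indicator) auto
        show "integrable \<psi> (\<lambda>x. \<Sum>i<k. indicator (A i) x :: real)" for k
          using A by (auto intro!: Bochner_Integration.integrable_sum integrable_const_bound[of _ 1])
      qed (use A in auto)
    qed (auto simp: Int_stable_def)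
  qed
  show ?thesis
    using a
  proof (induction rule: integrable_induct)
    case (base A c)
    show ?case using scale[OF ind[OF base(1)], of c] by simp
  next
    case (add f g)
    show ?case by (rule addP[OF add(1,3,2,4)])
  next
    case (lim f s)
    \<comment> \<open>The factor 2 is the domination that \<open>integrable_induct\<close> supplies
      for its approximating sequence.\<close>
    show ?case
      by (rule approx[where s=s and w="\<lambda>x. 2 * \<bar>f x\<bar>"]) (use lim sp in auto)
  qed
qed

text \<open>Pushing \<open>L x\<close> forward along \<open>Pair x\<close> moves the dependence on
  \<open>x\<close> out of the integrand and into the measure, where measurability of integration on
  \<open>subprob_algebra\<close> applies.\<close>

lemma measurable_kernel_integral:
  fixes g :: "'a \<times> 'b \<Rightarrow> real"
  assumes L: "L \<in> M \<rightarrow>\<^sub>M subprob_algebra N" and g: "g \<in> borel_measurable (M \<Otimes>\<^sub>M N)"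
  shows "(\<lambda>x. \<integral>y. g (x, y) \<partial>L x) \<in> borel_measurable M"
proof -
  have D: "(\<lambda>x. distr (L x) (M \<Otimes>\<^sub>M N) (Pair x)) \<in> M \<rightarrow>\<^sub>M subprob_algebra (M \<Otimes>\<^sub>M N)"
    by (rule measurable_distr2[OF _ L]) simp
  have "(\<lambda>x. \<integral>p. g p \<partial>distr (L x) (M \<Otimes>\<^sub>M N) (Pair x)) \<in> borel_measurable M"
    using measurable_compose[OF D integral_measurable_subprob_algebra[OF g]] .
  also have "?this \<longleftrightarrow> ?thesis"
  proof (rule measurable_cong)
    fix x assume x: "x \<in> space M"
    have "Pair x \<in> L x \<rightarrow>\<^sub>M M \<Otimes>\<^sub>M N"
      using x sets_kernel[OF L x] by (simp cong: measurable_cong_sets)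
    then show "(\<integral>p. g p \<partial>distr (L x) (M \<Otimes>\<^sub>M N) (Pair x)) = (\<integral>y. g (x, y) \<partial>L x)"
      using g by (simp add: integral_distr)
  qed
  finally show ?thesis .
qed

lemma (in prob_space) abs_integral_le_bound:
  fixes g :: "'a \<Rightarrow> real"
  assumes "\<And>x. \<bar>g x\<bar> \<le> C"
  shows "\<bar>\<integral>x. g x \<partial>M\<bar> \<le> C"
proof (cases "integrable M g")
  case True
  have "\<bar>\<integral>x. g x \<partial>M\<bar> \<le> (\<integral>x. \<bar>g x\<bar> \<partial>M)" by (rule integral_abs_bound)
  also have "\<dots> \<le> (\<integral>x. C \<partial>M)"
    using True assms by (intro integral_mono) auto
  finally show ?thesis by (simp add: prob_space)
next
  \<comment> \<open>A non-integrable function has integral 0 by convention, and the pointwise bound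
    forces \<open>0 \<le> C\<close>. This is why no measurability of \<open>g\<close> has to be
    assumed.\<close>
  case False
  then show ?thesis
    using assms[of undefined] by (simp add: not_integrable_integral_eq)
qed

lemma stationary_policyD:
  fixes \<gamma> :: "'x::topological_space \<Rightarrow> 'u::topological_space measure"
  assumes "stationary_policy \<gamma>"
  shows "prob_space (\<gamma> x)" "sets (\<gamma> x) = sets borel" "space (\<gamma> x) = UNIV"
    "\<gamma> \<in> borel \<rightarrow>\<^sub>M subprob_algebra borel"
proof -
  show s: "sets (\<gamma> x) = sets borel" using assms by (simp add: stationary_policy_def)
  show "space (\<gamma> x) = UNIV" using sets_eq_imp_space_eq[OF s] by simp
qed (use assms in \<open>auto simp: stationary_policy_def\<close>)

text \<open>Tent functions around a finite net, divided by their sum, which is positive because the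
  balls cover. The index is the centre itself, so that an integrand can later be sampled at it; the
  functions vanish for indices outside the net, which frees the bounds from a membership
  condition.\<close>

lemma compact_partition_of_unity:
  fixes r :: real
  assumes U: "compact (UNIV :: 'u::metric_space set)" and r: "0 < r"
  shows "\<exists>(I :: 'u set) \<rho>. finite I \<and> (\<forall>i. continuous_on UNIV (\<rho> i)) \<and>
           (\<forall>i u. 0 \<le> \<rho> i u \<and> \<rho> i u \<le> (1::real)) \<and> (\<forall>u. (\<Sum>i\<in>I. \<rho> i u) = 1) \<and>
           (\<forall>i u. \<rho> i u \<noteq> 0 \<longrightarrow> dist u i < r)"
proof -
  obtain I :: "'u set" where I: "finite I" "UNIV \<subseteq> (\<Union>i\<in>I. ball i r)"
    using U r unfolding compact_eq_totally_bounded by blast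
  define b where "b i u = max 0 (r - dist u i)" for i u :: 'u
  define \<rho> where "\<rho> i u = (if i \<in> I then b i u / (\<Sum>j\<in>I. b j u) else 0)" for i u
  have b0: "0 \<le> b i u" for i u by (simp add: b_def)
  have pos: "0 < (\<Sum>j\<in>I. b j u)" for u
  proof -
    obtain i where "i \<in> I" "u \<in> ball i r" using I by blast
    then have "0 < b i u" by (simp add: b_def dist_commute)
    then show ?thesis
      using sum_pos2[OF I(1) \<open>i \<in> I\<close>, of "\<lambda>j. b j u"] b0 by blast
  qed
  have "continuous_on UNIV (\<rho> i)" for i
  proof (cases "i \<in> I")
    case True
    then show ?thesis
      unfolding \<rho>_def using pos by (simp, intro continuous_intros) (auto simp: b_def less_imp_neq[symmetric] intro!: continuous_intros)
  qed (simp add: \<rho>_def)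
  moreover have "0 \<le> \<rho> i u \<and> \<rho> i u \<le> 1" for i u
    using pos[of u] b0 I(1) member_le_sum[of i I "\<lambda>j. b j u"]
    by (auto simp: \<rho>_def divide_le_eq intro!: divide_nonneg_nonneg sum_nonneg)
  moreover have "(\<Sum>i\<in>I. \<rho> i u) = 1" for u
    using pos[of u] by (simp add: \<rho>_def flip: sum_divide_distrib)
  moreover have "dist u i < r" if "\<rho> i u \<noteq> 0" for i u
    using that by (auto simp: \<rho>_def b_def split: if_splits)
  ultimately show ?thesis using I(1) by blast
qed

section \<open>Young convergence and Caratheodory integrands\<close>

text \<open>Young convergence only tests jointly continuous integrands. Since the action space is compact,
  a partition of unity splits a Caratheodory integrand into products of a measurable function of the
  state and a continuous function of the action, up to an error small in \<open>L\<^sup>1(\<psi>; C(U))\<close>.\<close>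

lemma young_conv_product:
  fixes \<psi> :: "'x::{metric_space, second_countable_topology} measure"
    and \<gamma>s :: "nat \<Rightarrow> 'x \<Rightarrow> 'u::{metric_space, second_countable_topology} measure"
  assumes \<psi>: "finite_measure \<psi>" "sets \<psi> = sets borel"
    and \<gamma>s: "\<And>n. stationary_policy (\<gamma>s n)" and \<gamma>: "stationary_policy \<gamma>"
    and conv: "young_conv \<psi> \<gamma>s \<gamma>"
    and \<rho>: "continuous_on UNIV \<rho>" "\<And>u. \<bar>\<rho> u\<bar> \<le> (1::real)"
    and a: "integrable \<psi> a"
  shows "(\<lambda>n. \<integral>x. a x * (\<integral>u. \<rho> u \<partial>\<gamma>s n x) \<partial>\<psi>) \<longlonglongrightarrow> (\<integral>x. a x * (\<integral>u. \<rho> u \<partial>\<gamma> x) \<partial>\<psi>)"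
proof (rule LIMSEQ_integral_weights[OF \<psi> _ _ _ _ _ a])
  have m: "(\<lambda>x. \<integral>u. \<rho> u \<partial>\<delta> x) \<in> borel_measurable \<psi>" if "stationary_policy \<delta>" for \<delta> :: "'x \<Rightarrow> 'u measure"
  proof -
    have "(\<lambda>x. \<integral>u. \<rho> u \<partial>\<delta> x) \<in> borel_measurable borel"
      using measurable_compose[OF stationary_policyD(4)[OF that] integral_measurable_subprob_algebra]
        borel_measurable_continuous_onI[OF \<rho>(1)] .
    then show ?thesis using \<psi> by (simp cong: measurable_cong_sets)
  qed
  show "(\<lambda>x. \<integral>u. \<rho> u \<partial>\<gamma>s n x) \<in> borel_measurable \<psi>" "(\<lambda>x. \<integral>u. \<rho> u \<partial>\<gamma> x) \<in> borel_measurable \<psi>" for n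
    using m \<gamma>s \<gamma> by auto
  have b: "\<bar>\<integral>u. \<rho> u \<partial>\<delta> x\<bar> \<le> 1" if "stationary_policy \<delta>" for \<delta> :: "'x \<Rightarrow> 'u measure" and x
    using prob_space.abs_integral_le_bound[OF stationary_policyD(1)[OF that] \<rho>(2)] .
  show "\<bar>\<integral>u. \<rho> u \<partial>\<gamma>s n x\<bar> \<le> 1" "\<bar>\<integral>u. \<rho> u \<partial>\<gamma> x\<bar> \<le> 1" for n x
    using b \<gamma>s \<gamma> by auto
  fix c :: "'x \<Rightarrow> real"
  assume c: "continuous_on UNIV c" "\<And>x. 0 \<le> c x \<and> c x \<le> 1"
  \<comment> \<open>For a continuous weight the product is an admissible Young test function, and
    \<open>c x\<close> leaves the inner integral as a constant.
    \<open>LIMSEQ_integral_weights\<close> then passes from \<open>c\<close> to the integrable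
    weight \<open>a\<close>.\<close>
  have cont: "continuous_on UNIV (\<lambda>p. c (fst p) * \<rho> (snd p))"
    by (intro continuous_intros continuous_on_compose2[OF c(1)] continuous_on_compose2[OF \<rho>(1)]) auto
  have "\<bar>c x * \<rho> u\<bar> \<le> 1" for x u
    using c(2)[of x] \<rho>(2)[of u] by (simp add: abs_mult mult_le_one)
  then have "bounded (range (\<lambda>p. c (fst p) * \<rho> (snd p)))"
    by (auto simp: bounded_iff)
  with cont show "(\<lambda>n. \<integral>x. c x * (\<integral>u. \<rho> u \<partial>\<gamma>s n x) \<partial>\<psi>) \<longlonglongrightarrow> (\<integral>x. c x * (\<integral>u. \<rho> u \<partial>\<gamma> x) \<partial>\<psi>)"
    using conv[unfolded young_conv_def, rule_format, of "\<lambda>p. c (fst p) * \<rho> (snd p)"] by simp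
qed

text \<open>What makes the approximation usable is that its error is a supremum over actions: it
  bounds the error of the inner integral under every policy alike, hence uniformly along the
  sequence.\<close>

lemma young_conv_caratheodory:
  fixes \<psi> :: "'x::{metric_space, second_countable_topology} measure"
    and \<gamma>s :: "nat \<Rightarrow> 'x \<Rightarrow> 'u::{metric_space, second_countable_topology} measure"
    and g :: "'x \<times> 'u \<Rightarrow> real"
  assumes U: "compact (UNIV :: 'u set)"
    and \<psi>: "finite_measure \<psi>" "sets \<psi> = sets borel"
    and \<gamma>s: "\<And>n. stationary_policy (\<gamma>s n)" and \<gamma>: "stationary_policy \<gamma>"
    and conv: "young_conv \<psi> \<gamma>s \<gamma>"
    and g: "g \<in> borel_measurable borel" "\<And>p. \<bar>g p\<bar> \<le> C" "\<And>x. continuous_on UNIV (\<lambda>u. g (x, u))"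
  shows "(\<lambda>n. \<integral>x. (\<integral>u. g (x, u) \<partial>\<gamma>s n x) \<partial>\<psi>) \<longlonglongrightarrow> (\<integral>x. (\<integral>u. g (x, u) \<partial>\<gamma> x) \<partial>\<psi>)"
proof -
  interpret finite_measure \<psi> by fact
  have "\<forall>k::nat. \<exists>(I :: 'u set) \<rho>. finite I \<and> (\<forall>i. continuous_on UNIV (\<rho> i)) \<and>
           (\<forall>i u. 0 \<le> \<rho> i u \<and> \<rho> i u \<le> (1::real)) \<and> (\<forall>u. (\<Sum>i\<in>I. \<rho> i u) = 1) \<and>
           (\<forall>i u. \<rho> i u \<noteq> 0 \<longrightarrow> dist u i < inverse (real (Suc k)))"
    by (intro allI compact_partition_of_unity[OF U]) simp
  then obtain I :: "nat \<Rightarrow> 'u set" and \<rho> :: "nat \<Rightarrow> 'u \<Rightarrow> 'u \<Rightarrow> real"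
    where I: "\<And>k. finite (I k)"
      and \<rho>: "\<And>k i. continuous_on UNIV (\<rho> k i)" "\<And>k i u. 0 \<le> \<rho> k i u \<and> \<rho> k i u \<le> 1"
        "\<And>k u. (\<Sum>i\<in>I k. \<rho> k i u) = 1" "\<And>k i u. \<rho> k i u \<noteq> 0 \<Longrightarrow> dist u i < inverse (real (Suc k))"
    by metis
  \<comment> \<open>Interpolation of \<open>g (x, _)\<close> from its values at the centres: a
    finite sum of products of a measurable function of \<open>x\<close> and a continuous function of
    \<open>u\<close>.\<close>
  define G where "G k x u = (\<Sum>i\<in>I k. g (x, i) * \<rho> k i u)" for k x u
  have diff: "\<bar>G k x u - g (x, u)\<bar> \<le> e"
    if "\<And>v w. dist v w < inverse (real (Suc k)) \<Longrightarrow> \<bar>g (x, w) - g (x, v)\<bar> \<le> e" for k x u e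
  proof -
    have "G k x u - g (x, u) = (\<Sum>i\<in>I k. (g (x, i) - g (x, u)) * \<rho> k i u)"
      using \<rho>(3)[where u=u and k=k] by (simp add: G_def left_diff_distrib sum_subtractf flip: sum_distrib_left)
    also have "\<bar>\<dots>\<bar> \<le> (\<Sum>i\<in>I k. \<bar>(g (x, i) - g (x, u)) * \<rho> k i u\<bar>)" by (rule sum_abs)
    also have "\<dots> \<le> (\<Sum>i\<in>I k. e * \<rho> k i u)"
    proof (rule sum_mono)
      fix i
      show "\<bar>(g (x, i) - g (x, u)) * \<rho> k i u\<bar> \<le> e * \<rho> k i u"
        using that[of u i] \<rho>(4)[of k i u] \<rho>(2)[of k i u] by (cases "\<rho> k i u = 0") (auto simp: abs_mult intro!: mult_right_mono)
    qed
    also have "\<dots> = e" using \<rho>(3) by (simp flip: sum_distrib_left)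
    finally show ?thesis .
  qed
  have Gb: "\<bar>G k x u - g (x, u)\<bar> \<le> 2 * C" for k x u
  proof (rule diff)
    show "\<bar>g (x, w) - g (x, v)\<bar> \<le> 2 * C" for v w
      using g(2)[of "(x, v)"] g(2)[of "(x, w)"] by linarith
  qed
  \<comment> \<open>The supremum is taken over a countable dense set to keep \<open>W k\<close>
    measurable; continuity in \<open>u\<close> makes it a bound for all actions.\<close>
  obtain D :: "'u set" where D: "countable D" "UNIV \<subseteq> closure D"
    using separable[of "UNIV :: 'u set"] by metis
  have Dne: "D \<noteq> {}" using D(2) by auto
  define W where "W k x = (SUP u\<in>D. \<bar>G k x u - g (x, u)\<bar>)" for k x
  have bdd: "bdd_above ((\<lambda>u. \<bar>G k x u - g (x, u)\<bar>) ` D)" for k x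
    using Gb by (intro bdd_aboveI2)
  have gm: "g \<in> borel_measurable (borel \<Otimes>\<^sub>M borel)" using g(1) by (simp add: borel_prod)
  have gx: "(\<lambda>x. g (x, u)) \<in> borel_measurable borel" for u
    by (rule measurable_compose[OF _ gm]) simp
  have gx\<psi>: "(\<lambda>x. g (x, u)) \<in> borel_measurable \<psi>" for u
    using gx \<psi> by (simp cong: measurable_cong_sets)
  have Wm: "W k \<in> borel_measurable \<psi>" for k
    unfolding W_def[abs_def] G_def
    by (intro borel_measurable_cSUP D borel_measurable_abs borel_measurable_diff borel_measurable_sum
        borel_measurable_times gx\<psi> borel_measurable_const bdd[unfolded G_def])
  have GW: "\<bar>G k x u - g (x, u)\<bar> \<le> W k x" for k x u
  proof -
    have "closed {u. \<bar>G k x u - g (x, u)\<bar> \<le> W k x}"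
      unfolding G_def by (intro closed_Collect_le continuous_intros g \<rho>)
    moreover have "D \<subseteq> {u. \<bar>G k x u - g (x, u)\<bar> \<le> W k x}"
      unfolding W_def using bdd by (auto intro: cSUP_upper)
    ultimately have "closure D \<subseteq> {u. \<bar>G k x u - g (x, u)\<bar> \<le> W k x}"
      by (rule closure_minimal[rotated])
    then show ?thesis using D by auto
  qed
  have W0: "0 \<le> W k x" for k x using GW[of k x undefined] by linarith
  have Wle: "W k x \<le> e" if "\<And>u. \<bar>G k x u - g (x, u)\<bar> \<le> e" for k x e
    unfolding W_def using Dne that by (intro cSUP_least)
  \<comment> \<open>Compactness gives a modulus of continuity in \<open>u\<close> for each fixed
    \<open>x\<close>. It may vary with \<open>x\<close>, so convergence is pointwise here and
    becomes L^1 convergence by domination with \<open>2 * C\<close>.\<close>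
  have Wlim: "(\<lambda>k. W k x) \<longlonglongrightarrow> 0" for x
  proof (rule LIMSEQ_I)
    fix r :: real assume r: "0 < r"
    have "uniformly_continuous_on UNIV (\<lambda>u. g (x, u))"
      using compact_uniformly_continuous[OF g(3) U] .
    then obtain d where d: "0 < d" "\<And>v w. dist v w < d \<Longrightarrow> dist (g (x, v)) (g (x, w)) < r / 2"
      using r unfolding uniformly_continuous_on_def by (metis UNIV_I half_gt_zero)
    obtain k0 where k0: "inverse (real (Suc k0)) < d" using reals_Archimedean[OF d(1)] by auto
    have "norm (W k x - 0) < r" if "k \<ge> k0" for k
    proof -
      have le: "inverse (real (Suc k)) \<le> inverse (real (Suc k0))" using that by simp
      have "\<bar>g (x, w) - g (x, v)\<bar> \<le> r / 2" if vw: "dist v w < inverse (real (Suc k))" for v w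
      proof -
        have "dist v w < d" using vw le k0 by linarith
        from d(2)[OF this] show ?thesis by (simp add: dist_real_def abs_minus_commute)
      qed
      from diff[OF this] have "W k x \<le> r / 2" by (rule Wle)
      then show ?thesis using W0[of k x] r by simp
    qed
    then show "\<exists>k0. \<forall>k\<ge>k0. norm (W k x - 0) < r" by blast
  qed
  have Wb: "norm (W k x) \<le> 2 * C" for k x
    using W0[of k x] Wle[OF Gb, of k x] by simp
  have Wint: "integrable \<psi> (W k)" for k
    by (rule integrable_const_bound[OF AE_I2[OF Wb] Wm])
  have Wlim_int: "(\<lambda>k. \<integral>x. W k x \<partial>\<psi>) \<longlonglongrightarrow> 0"
  proof -
    have "(\<lambda>k. \<integral>x. W k x \<partial>\<psi>) \<longlonglongrightarrow> (\<integral>x. 0 \<partial>\<psi>)"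
      using Wm Wb Wlim by (intro integral_dominated_convergence[where w="\<lambda>_. 2 * C"] AE_I2) simp_all
    then show ?thesis by simp
  qed
  have gxi: "integrable \<psi> (\<lambda>x. g (x, i))" for i
    using g(2) gx\<psi> by (intro integrable_const_bound[of _ C] AE_I2) simp_all
  have rint: "integrable (\<delta> x) (\<rho> k i)" if "stationary_policy \<delta>" for \<delta> :: "'x \<Rightarrow> 'u measure" and x k i
  proof -
    interpret d: prob_space "\<delta> x" by (rule stationary_policyD[OF that])
    have "\<rho> k i \<in> borel_measurable (\<delta> x)"
      unfolding measurable_cong_sets[OF stationary_policyD(2)[OF that] refl]
      by (rule borel_measurable_continuous_onI[OF \<rho>(1)])
    then show ?thesis
      by (rule d.integrable_const_bound[of _ 1, rotated]) (simp add: \<rho>(2))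
  qed
  have rb: "(\<lambda>x. \<integral>u. \<rho> k i u \<partial>\<delta> x) \<in> borel_measurable \<psi>" "\<bar>\<integral>u. \<rho> k i u \<partial>\<delta> x\<bar> \<le> 1"
    if "stationary_policy \<delta>" for \<delta> :: "'x \<Rightarrow> 'u measure" and k i x
  proof -
    have "(\<lambda>x. \<integral>u. \<rho> k i u \<partial>\<delta> x) \<in> borel_measurable borel"
      using measurable_compose[OF stationary_policyD(4)[OF that] integral_measurable_subprob_algebra]
        borel_measurable_continuous_onI[OF \<rho>(1)] .
    then show "(\<lambda>x. \<integral>u. \<rho> k i u \<partial>\<delta> x) \<in> borel_measurable \<psi>"
      using \<psi> by (simp cong: measurable_cong_sets)
    show "\<bar>\<integral>u. \<rho> k i u \<partial>\<delta> x\<bar> \<le> 1"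
      by (rule prob_space.abs_integral_le_bound[OF stationary_policyD(1)[OF that]]) (simp add: \<rho>(2))
  qed
  have Gexp: "(\<integral>u. G k x u \<partial>\<delta> x) = (\<Sum>i\<in>I k. g (x, i) * (\<integral>u. \<rho> k i u \<partial>\<delta> x))"
    if "stationary_policy \<delta>" for \<delta> :: "'x \<Rightarrow> 'u measure" and x k
    unfolding G_def using rint[OF that] by simp
  have prodint: "integrable \<psi> (\<lambda>x. g (x, i) * (\<integral>u. \<rho> k i u \<partial>\<delta> x))"
    if "stationary_policy \<delta>" for \<delta> :: "'x \<Rightarrow> 'u measure" and k i
    by (rule integrable_mult_bounded[OF gxi rb[OF that]])
  have Gint: "integrable \<psi> (\<lambda>x. \<integral>u. G k x u \<partial>\<delta> x)"
    if "stationary_policy \<delta>" for \<delta> :: "'x \<Rightarrow> 'u measure" and k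
    unfolding Gexp[OF that] by (intro Bochner_Integration.integrable_sum prodint that)
  have approx: "\<bar>(\<integral>x. (\<integral>u. G k x u \<partial>\<delta> x) \<partial>\<psi>) - (\<integral>x. (\<integral>u. g (x, u) \<partial>\<delta> x) \<partial>\<psi>)\<bar> \<le> (\<integral>x. W k x \<partial>\<psi>)"
    if \<delta>: "stationary_policy \<delta>" for \<delta> :: "'x \<Rightarrow> 'u measure" and k
  proof -
    have gint: "integrable \<psi> (\<lambda>x. \<integral>u. g (x, u) \<partial>\<delta> x)"
    proof (rule integrable_const_bound[of _ C])
      show "AE x in \<psi>. norm (\<integral>u. g (x, u) \<partial>\<delta> x) \<le> C"
        using prob_space.abs_integral_le_bound[OF stationary_policyD(1)[OF \<delta>] g(2)] by simp
      show "(\<lambda>x. \<integral>u. g (x, u) \<partial>\<delta> x) \<in> borel_measurable \<psi>"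
        using measurable_kernel_integral[OF stationary_policyD(4)[OF \<delta>] gm] \<psi> by (simp cong: measurable_cong_sets)
    qed
    have inner: "\<bar>(\<integral>u. G k x u \<partial>\<delta> x) - (\<integral>u. g (x, u) \<partial>\<delta> x)\<bar> \<le> W k x" for x
    proof -
      interpret d: prob_space "\<delta> x" by (rule stationary_policyD[OF \<delta>])
      have "(\<lambda>u. g (x, u)) \<in> borel_measurable (\<delta> x)"
        unfolding measurable_cong_sets[OF stationary_policyD(2)[OF \<delta>] refl]
        by (rule borel_measurable_continuous_onI[OF g(3)])
      then have "integrable (\<delta> x) (\<lambda>u. g (x, u))"
        by (rule d.integrable_const_bound[of _ C, rotated]) (simp add: g(2))
      moreover have "integrable (\<delta> x) (G k x)"
        unfolding G_def[abs_def] using rint[OF \<delta>] by simp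
      ultimately have "(\<integral>u. G k x u \<partial>\<delta> x) - (\<integral>u. g (x, u) \<partial>\<delta> x) = (\<integral>u. G k x u - g (x, u) \<partial>\<delta> x)"
        by simp
      then show ?thesis using d.abs_integral_le_bound[OF GW] by simp
    qed
    have "(\<integral>x. (\<integral>u. G k x u \<partial>\<delta> x) \<partial>\<psi>) - (\<integral>x. (\<integral>u. g (x, u) \<partial>\<delta> x) \<partial>\<psi>)
        = (\<integral>x. (\<integral>u. G k x u \<partial>\<delta> x) - (\<integral>u. g (x, u) \<partial>\<delta> x) \<partial>\<psi>)"
      using Gint[OF \<delta>] gint by simp
    also have "\<bar>\<dots>\<bar> \<le> (\<integral>x. \<bar>(\<integral>u. G k x u \<partial>\<delta> x) - (\<integral>u. g (x, u) \<partial>\<delta> x)\<bar> \<partial>\<psi>)"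
      by (rule integral_abs_bound)
    also have "\<dots> \<le> (\<integral>x. W k x \<partial>\<psi>)"
      using Gint[OF \<delta>] gint Wint inner by (intro integral_mono) auto
    finally show ?thesis .
  qed
  show ?thesis
  proof (rule LIMSEQ_uniform_approx[where e="\<lambda>k. \<integral>x. W k x \<partial>\<psi>"
        and X="\<lambda>k n. \<integral>x. (\<integral>u. G k x u \<partial>\<gamma>s n x) \<partial>\<psi>" and L="\<lambda>k. \<integral>x. (\<integral>u. G k x u \<partial>\<gamma> x) \<partial>\<psi>"])
    fix k
    show "\<bar>(\<integral>x. (\<integral>u. G k x u \<partial>\<gamma>s n x) \<partial>\<psi>) - (\<integral>x. (\<integral>u. g (x, u) \<partial>\<gamma>s n x) \<partial>\<psi>)\<bar> \<le> (\<integral>x. W k x \<partial>\<psi>)" for n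
      by (rule approx[OF \<gamma>s])
    show "\<bar>(\<integral>x. (\<integral>u. G k x u \<partial>\<gamma> x) \<partial>\<psi>) - (\<integral>x. (\<integral>u. g (x, u) \<partial>\<gamma> x) \<partial>\<psi>)\<bar> \<le> (\<integral>x. W k x \<partial>\<psi>)"
      by (rule approx[OF \<gamma>])
    have "\<bar>\<rho> k i u\<bar> \<le> 1" for i u using \<rho>(2)[of k i u] by linarith
    from young_conv_product[OF \<psi> \<gamma>s \<gamma> conv \<rho>(1) this gxi]
    have "(\<lambda>n. \<Sum>i\<in>I k. \<integral>x. g (x, i) * (\<integral>u. \<rho> k i u \<partial>\<gamma>s n x) \<partial>\<psi>)
        \<longlonglongrightarrow> (\<Sum>i\<in>I k. \<integral>x. g (x, i) * (\<integral>u. \<rho> k i u \<partial>\<gamma> x) \<partial>\<psi>)"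
      by (rule tendsto_sum)
    moreover have "(\<integral>x. (\<integral>u. G k x u \<partial>\<delta> x) \<partial>\<psi>) = (\<Sum>i\<in>I k. \<integral>x. g (x, i) * (\<integral>u. \<rho> k i u \<partial>\<delta> x) \<partial>\<psi>)"
      if "stationary_policy \<delta>" for \<delta> :: "'x \<Rightarrow> 'u measure"
      unfolding Gexp[OF that] by (rule Bochner_Integration.integral_sum) (rule prodint[OF that])
    ultimately show "(\<lambda>n. \<integral>x. (\<integral>u. G k x u \<partial>\<gamma>s n x) \<partial>\<psi>) \<longlonglongrightarrow> (\<integral>x. (\<integral>u. G k x u \<partial>\<gamma> x) \<partial>\<psi>)"
      using \<gamma>s \<gamma> by simp
  qed (rule Wlim_int)
qed

section \<open>Equicontinuous densities\<close>

text \<open>\<open>S\<close> is the complement of the union of all open null sets. By Lindelof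
  countably many of them have the same union, so the union is null as well.\<close>

lemma support_exists:
  fixes \<psi> :: "'a::{metric_space, second_countable_topology} measure"
  assumes "sets \<psi> = sets borel"
  shows "\<exists>S. closed S \<and> emeasure \<psi> (- S) = 0 \<and> (\<forall>y\<in>S. \<forall>r>0. emeasure \<psi> (ball y r) \<noteq> 0)"
proof -
  define \<F> where "\<F> = {B. open B \<and> emeasure \<psi> B = 0}"
  obtain \<F>' where \<F>': "\<F>' \<subseteq> \<F>" "countable \<F>'" "\<Union>\<F>' = \<Union>\<F>"
    using Lindelof[of \<F>] by (auto simp: \<F>_def)
  have "(\<Union>B\<in>\<F>'. B) \<in> null_sets \<psi>"
    using \<F>' assms by (intro null_sets_UN') (auto simp: null_sets_def \<F>_def)
  then have "emeasure \<psi> (- (- \<Union>\<F>)) = 0"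
    using \<F>'(3) by auto
  moreover have "closed (- \<Union>\<F>)"
    unfolding closed_def by (auto simp: \<F>_def intro!: open_Union)
  moreover have "emeasure \<psi> (ball y r) \<noteq> 0" if "y \<in> - \<Union>\<F>" "0 < r" for y r
    using that by (auto simp: \<F>_def)
  ultimately show ?thesis by blast
qed

lemma measurable_measure_ball:
  fixes \<psi> :: "'a::{metric_space, second_countable_topology} measure"
  assumes "finite_measure \<psi>" "sets \<psi> = sets borel"
  shows "(\<lambda>y. measure \<psi> (ball y r)) \<in> borel_measurable borel"
proof -
  interpret finite_measure \<psi> by fact
  have "{p :: 'a \<times> 'a. dist (fst p) (snd p) < r} \<in> sets borel"
    by (intro borel_open open_Collect_less continuous_intros)
  then have "{p :: 'a \<times> 'a. dist (fst p) (snd p) < r} \<in> sets (borel \<Otimes>\<^sub>M \<psi>)"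
    using assms(2) by (simp add: borel_prod[symmetric] cong: sets_pair_measure_cong)
  from measurable_emeasure_Pair[OF this]
  have "(\<lambda>y. emeasure \<psi> (ball y r)) \<in> borel_measurable borel"
    by (simp add: ball_def vimage_def)
  then show ?thesis unfolding measure_def by (rule borel_measurable_enn2real)
qed

text \<open>Both the measure and the ball move with \<open>q\<close>; the balls are handled as the
  sections of one measurable set in the triple product.\<close>

lemma measurable_kernel_measure_ball:
  fixes K :: "'p \<Rightarrow> 'a::{metric_space, second_countable_topology} measure"
  assumes "K \<in> N \<rightarrow>\<^sub>M subprob_algebra borel"
  shows "(\<lambda>q. measure (K (fst q)) (ball (snd q) r)) \<in> borel_measurable (N \<Otimes>\<^sub>M borel)"
proof (rule measure_measurable_subprob_algebra2)
  show "(\<lambda>q. K (fst q)) \<in> N \<Otimes>\<^sub>M borel \<rightarrow>\<^sub>M subprob_algebra borel"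
    using assms by (rule measurable_compose[OF measurable_fst])
  have "{q \<in> space ((N \<Otimes>\<^sub>M borel) \<Otimes>\<^sub>M borel). dist (snd (fst q)) (snd q) < r} \<in> sets ((N \<Otimes>\<^sub>M borel) \<Otimes>\<^sub>M (borel :: 'a measure))"
    by measurable
  also have "{q \<in> space ((N \<Otimes>\<^sub>M borel) \<Otimes>\<^sub>M borel). dist (snd (fst q)) (snd q) < r} =
      (SIGMA q:space (N \<Otimes>\<^sub>M borel). ball (snd q) r)"
    by (auto simp: space_pair_measure)
  finally show "(SIGMA q:space (N \<Otimes>\<^sub>M borel). ball (snd q) r) \<in> sets ((N \<Otimes>\<^sub>M borel) \<Otimes>\<^sub>M (borel :: 'a measure))" .
qed

text \<open>The quotient is the mean of \<open>f\<close> over the ball, so it differs from the value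
  at the centre by at most the oscillation. Positive mass of the ball is what makes the quotient a
  mean.\<close>

lemma ratio_ball_close:
  fixes f :: "'a::{metric_space, second_countable_topology} \<Rightarrow> real"
  assumes \<psi>: "finite_measure \<psi>" "sets \<psi> = sets borel"
    and f: "f \<in> borel_measurable borel" "\<And>y. 0 \<le> f y" "\<And>y. f y \<le> M"
    and pos: "emeasure \<psi> (ball y r) \<noteq> 0"
    and close: "\<And>z. z \<in> ball y r \<Longrightarrow> \<bar>f z - f y\<bar> \<le> e"
  shows "\<bar>measure (density \<psi> (\<lambda>z. ennreal (f z))) (ball y r) / measure \<psi> (ball y r) - f y\<bar> \<le> e"
proof -
  interpret finite_measure \<psi> by fact
  have B: "ball y r \<in> sets \<psi>" using \<psi> by simp
  have fm: "f \<in> borel_measurable \<psi>" using f(1) \<psi>(2) by (simp cong: measurable_cong_sets)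
  have mpos: "0 < measure \<psi> (ball y r)"
    using pos by (simp add: emeasure_eq_measure zero_less_measure_iff)
  have int: "integrable \<psi> (\<lambda>z. indicator (ball y r) z * f z)"
  proof (rule integrable_const_bound[of _ M, OF AE_I2])
    show "norm (indicator (ball y r) z * f z) \<le> M" for z
      using f(2,3)[of z] by (auto simp: indicator_def)
    show "(\<lambda>z. indicator (ball y r) z * f z) \<in> borel_measurable \<psi>"
      using fm B by (intro borel_measurable_times borel_measurable_indicator)
  qed
  have inti: "integrable \<psi> (indicator (ball y r) :: 'a \<Rightarrow> real)"
    using B by (intro integrable_const_bound[of _ 1] AE_I2) auto
  have "emeasure (density \<psi> (\<lambda>z. ennreal (f z))) (ball y r) = (\<integral>\<^sup>+z. ennreal (indicator (ball y r) z * f z) \<partial>\<psi>)"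
    using B fm by (subst emeasure_density) (auto intro!: nn_integral_cong simp: indicator_def)
  also have "\<dots> = ennreal (\<integral>z. indicator (ball y r) z * f z \<partial>\<psi>)"
    using int f by (intro nn_integral_eq_integral) auto
  finally have eq: "measure (density \<psi> (\<lambda>z. ennreal (f z))) (ball y r) = (\<integral>z. indicator (ball y r) z * f z \<partial>\<psi>)"
    using f by (simp add: measure_def integral_nonneg_AE)
  have mi: "measure \<psi> (ball y r) = (\<integral>z. indicator (ball y r) z \<partial>\<psi>)"
    using B by (simp add: sets.Int_space_eq2)
  have "(\<integral>z. indicator (ball y r) z * f z \<partial>\<psi>) - f y * measure \<psi> (ball y r)
      = (\<integral>z. indicator (ball y r) z * f z - f y * indicator (ball y r) z \<partial>\<psi>)"
    using int inti unfolding mi by simp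
  also have "\<bar>\<dots>\<bar> \<le> (\<integral>z. \<bar>indicator (ball y r) z * f z - f y * indicator (ball y r) z\<bar> \<partial>\<psi>)"
    by (rule integral_abs_bound)
  also have "\<dots> \<le> (\<integral>z. e * indicator (ball y r) z \<partial>\<psi>)"
  proof (rule integral_mono)
    show "integrable \<psi> (\<lambda>z. \<bar>indicator (ball y r) z * f z - f y * indicator (ball y r) z\<bar>)"
      "integrable \<psi> (\<lambda>z. e * indicator (ball y r) z)"
      by (intro integrable_abs Bochner_Integration.integrable_diff int integrable_mult_right inti)+
    show "\<bar>indicator (ball y r) z * f z - f y * indicator (ball y r) z\<bar> \<le> e * indicator (ball y r) z" for z
      using close[of z] by (auto simp: indicator_def)
  qed
  also have "\<dots> = e * measure \<psi> (ball y r)" unfolding mi by simp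
  finally have le: "\<bar>(\<integral>z. indicator (ball y r) z * f z \<partial>\<psi>) - f y * measure \<psi> (ball y r)\<bar> \<le> e * measure \<psi> (ball y r)" .
  have "(\<integral>z. indicator (ball y r) z * f z \<partial>\<psi>) / measure \<psi> (ball y r) - f y
      = ((\<integral>z. indicator (ball y r) z * f z \<partial>\<psi>) - f y * measure \<psi> (ball y r)) / measure \<psi> (ball y r)"
    using mpos by (simp add: field_simps)
  then show ?thesis
    using le mpos unfolding eq by (simp add: divide_le_eq)
qed

text \<open>The densities \<open>f p\<close> are only given separately for each parameter. On the support of \<open>\<psi>\<close> they are
  recovered as limits of ratios of masses of balls, which makes them jointly measurable there.\<close>

lemma kernel_jointly_measurable_density:
  fixes K :: "'p \<Rightarrow> 'a::{metric_space, second_countable_topology} measure"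
  assumes \<psi>: "finite_measure \<psi>" "sets \<psi> = sets borel"
    and K: "K \<in> N \<rightarrow>\<^sub>M subprob_algebra borel"
    and f: "\<And>p. f p \<in> borel_measurable borel" "\<And>p y. 0 \<le> f p y" "\<And>p y. f p y \<le> M"
    and dens: "\<And>p. K p = density \<psi> (\<lambda>y. ennreal (f p y))"
    and equi: "\<And>y e. 0 < e \<Longrightarrow> \<exists>d>0. \<forall>p y'. dist y' y < d \<longrightarrow> \<bar>f p y' - f p y\<bar> < e"
    and S: "closed S" "emeasure \<psi> (- S) = 0" "\<And>y r. y \<in> S \<Longrightarrow> 0 < r \<Longrightarrow> emeasure \<psi> (ball y r) \<noteq> 0"
  shows "(\<lambda>q. indicator S (snd q) * f (fst q) (snd q)) \<in> borel_measurable (N \<Otimes>\<^sub>M borel)"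
    and "K p = density \<psi> (\<lambda>y. ennreal (indicator S y * f p y))"
proof -
  show "(\<lambda>q. indicator S (snd q) * f (fst q) (snd q)) \<in> borel_measurable (N \<Otimes>\<^sub>M borel)"
  proof (rule borel_measurable_LIMSEQ_real)
    let ?r = "\<lambda>k::nat. inverse (real (Suc k))"
    \<comment> \<open>Off \<open>S\<close> a ball may have mass zero; there the indicator makes the
      value of the quotient irrelevant.\<close>
    let ?G = "\<lambda>k q. indicator S (snd q) * (measure (K (fst q)) (ball (snd q) (?r k)) / measure \<psi> (ball (snd q) (?r k)))"
    have Sm: "(\<lambda>q. indicator S (snd q) :: real) \<in> borel_measurable (N \<Otimes>\<^sub>M borel)"
      using S(1) by (intro measurable_compose[OF measurable_snd] borel_measurable_indicator) simp
    show "?G k \<in> borel_measurable (N \<Otimes>\<^sub>M borel)" for k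
      by (intro borel_measurable_times borel_measurable_divide Sm measurable_kernel_measure_ball K
          measurable_compose[OF measurable_snd measurable_measure_ball[OF \<psi>]])
    fix q
    show "(\<lambda>k. ?G k q) \<longlonglongrightarrow> indicator S (snd q) * f (fst q) (snd q)"
    proof (cases "snd q \<in> S")
      case True
      have "(\<lambda>k. measure (K (fst q)) (ball (snd q) (?r k)) / measure \<psi> (ball (snd q) (?r k))) \<longlonglongrightarrow> f (fst q) (snd q)"
      proof (rule LIMSEQ_I)
        fix e :: real assume e: "0 < e"
        then obtain d where d: "0 < d" "\<And>p y'. dist y' (snd q) < d \<Longrightarrow> \<bar>f p y' - f p (snd q)\<bar> < e / 2"
          using equi[of "e / 2" "snd q"] by auto
        obtain k0 where k0: "?r k0 < d" using reals_Archimedean[OF d(1)] by auto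
        have "norm (measure (K (fst q)) (ball (snd q) (?r k)) / measure \<psi> (ball (snd q) (?r k)) - f (fst q) (snd q)) < e"
          if "k \<ge> k0" for k
        proof -
          have le: "?r k \<le> ?r k0" using that by simp
          have "\<bar>f (fst q) z - f (fst q) (snd q)\<bar> \<le> e / 2" if "z \<in> ball (snd q) (?r k)" for z
          proof -
            have "dist z (snd q) < d" using that le k0 unfolding mem_ball dist_commute[of z] by linarith
            from d(2)[OF this, of "fst q"] show ?thesis by simp
          qed
          moreover have "0 < ?r k" by simp
          ultimately have "\<bar>measure (K (fst q)) (ball (snd q) (?r k)) / measure \<psi> (ball (snd q) (?r k)) - f (fst q) (snd q)\<bar> \<le> e / 2"
            unfolding dens by (intro ratio_ball_close[OF \<psi> f] S(3)[OF True])
          then show ?thesis using e by simp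
        qed
        then show "\<exists>k0. \<forall>k\<ge>k0. norm (measure (K (fst q)) (ball (snd q) (?r k)) / measure \<psi> (ball (snd q) (?r k)) - f (fst q) (snd q)) < e"
          by blast
      qed
      then show ?thesis using True by simp
    qed simp
  qed
  have "- S \<in> null_sets \<psi>" using S \<psi> by (auto simp: null_sets_def)
  then have "AE y in \<psi>. y \<in> S" by (rule AE_I') auto
  then show "K p = density \<psi> (\<lambda>y. ennreal (indicator S y * f p y))"
    unfolding dens using f(1)[of p] S(1) \<psi>(2)
    by (intro density_cong) (auto cong: measurable_cong_sets elim!: AE_mp)
qed

text \<open>The Arzela-Ascoli argument on a set that is merely separable: a diagonal choice gives
  convergence on a countable dense subset, and equicontinuity transfers the Cauchy property to every
  point of \<open>S\<close>. Only pointwise convergence is claimed, so compactness of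
  \<open>S\<close> does not enter.\<close>

lemma equicontinuous_pointwise_convergent_subsequence:
  fixes h :: "nat \<Rightarrow> 'a::{metric_space, second_countable_topology} \<Rightarrow> real"
  assumes bound: "\<And>n y. \<bar>h n y\<bar> \<le> M"
    and equi: "\<And>y e. y \<in> S \<Longrightarrow> 0 < e \<Longrightarrow> \<exists>d>0. \<forall>n. \<forall>y'\<in>S. dist y' y < d \<longrightarrow> \<bar>h n y' - h n y\<bar> \<le> e"
  shows "\<exists>r :: nat \<Rightarrow> nat. strict_mono r \<and> (\<forall>y\<in>S. convergent (\<lambda>k. h (r k) y))"
proof -
  obtain D where D: "countable D" "D \<subseteq> S" "S \<subseteq> closure D"
    using separable[of S] by metis
  obtain r :: "nat \<Rightarrow> nat" where r: "strict_mono r" "\<And>y. y \<in> D \<Longrightarrow> \<exists>l. (\<lambda>k. h (r k) y) \<longlonglongrightarrow> l"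
    using function_convergent_subsequence[OF D(1), of h M] bound by (metis real_norm_def)
  have "Cauchy (\<lambda>k. h (r k) y)" if y: "y \<in> S" for y
  proof (rule metric_CauchyI)
    fix e :: real assume e: "0 < e"
    then obtain d where d: "0 < d" "\<And>n y'. y' \<in> S \<Longrightarrow> dist y' y < d \<Longrightarrow> \<bar>h n y' - h n y\<bar> \<le> e / 4"
      using equi[OF y, of "e / 4"] by auto
    obtain z where z: "z \<in> D" "dist z y < d"
      using D(3) y d(1) closure_approachable by blast
    have "Cauchy (\<lambda>k. h (r k) z)" using r(2)[OF z(1)] LIMSEQ_imp_Cauchy by blast
    then obtain k0 where k0: "\<And>m n. m \<ge> k0 \<Longrightarrow> n \<ge> k0 \<Longrightarrow> dist (h (r m) z) (h (r n) z) < e / 4"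
      using e metric_CauchyD[of "\<lambda>k. h (r k) z" "e / 4"] by (metis zero_less_divide_iff zero_less_numeral)
    have "dist (h (r m) y) (h (r n) y) < e" if "m \<ge> k0" "n \<ge> k0" for m n
    proof -
      have "z \<in> S" using z D by auto
      from d(2)[OF this z(2), of "r m"] d(2)[OF this z(2), of "r n"] k0[OF that] e
      show ?thesis unfolding dist_real_def by linarith
    qed
    then show "\<exists>k0. \<forall>m\<ge>k0. \<forall>n\<ge>k0. dist (h (r m) y) (h (r n) y) < e" by blast
  qed
  then show ?thesis using r(1) real_Cauchy_convergent by blast
qed

section \<open>State-action measures\<close>

lemma kernel_measurable_borel:
  assumes "markov_kernel T"
  shows "(\<lambda>p. T (fst p) (snd p)) \<in> borel \<rightarrow>\<^sub>M subprob_algebra borel"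
  using assms by (simp add: markov_kernel_def case_prod_unfold)

lemma kernel_integral_bounded:
  fixes T :: "'x::topological_space \<Rightarrow> 'u::topological_space \<Rightarrow> 'x measure" and c :: "'x \<Rightarrow> real"
  assumes T: "markov_kernel T"
    and c: "c \<in> borel_measurable borel" "\<And>x. 0 \<le> c x" "\<And>x. c x \<le> 1"
  shows "(\<lambda>p. \<integral>z. c z \<partial>T (fst p) (snd p)) \<in> borel_measurable borel"
    and "0 \<le> (\<integral>z. c z \<partial>T x u)" and "(\<integral>z. c z \<partial>T x u) \<le> 1"
    and "(\<integral>\<^sup>+z. ennreal (c z) \<partial>T x u) = ennreal (\<integral>z. c z \<partial>T x u)"
proof -
  show "(\<lambda>p. \<integral>z. c z \<partial>T (fst p) (snd p)) \<in> borel_measurable borel"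
    using measurable_compose[OF kernel_measurable_borel[OF T] integral_measurable_subprob_algebra[OF c(1)]] .
  interpret Q: prob_space "T x u" using T by (simp add: markov_kernel_def)
  have "sets (T x u) = sets borel" using T by (simp add: markov_kernel_def)
  then have "integrable (T x u) c"
    using c by (intro Q.integrable_const_bound[of _ 1] AE_I2) (simp_all cong: measurable_cong_sets)
  then show "(\<integral>\<^sup>+z. ennreal (c z) \<partial>T x u) = ennreal (\<integral>z. c z \<partial>T x u)"
    using c by (intro nn_integral_eq_integral) simp_all
  show "0 \<le> (\<integral>z. c z \<partial>T x u)" using c by simp
  have "\<bar>\<integral>z. c z \<partial>T x u\<bar> \<le> 1" using c by (intro Q.abs_integral_le_bound) simp
  then show "(\<integral>z. c z \<partial>T x u) \<le> 1" by simp
qed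

lemma measurable_Pair_policy:
  fixes \<gamma> :: "'x::second_countable_topology \<Rightarrow> 'u::second_countable_topology measure"
  assumes \<gamma>: "stationary_policy \<gamma>"
  shows "Pair x \<in> \<gamma> x \<rightarrow>\<^sub>M borel"
proof -
  have "Pair x \<in> (borel :: 'u measure) \<rightarrow>\<^sub>M (borel \<Otimes>\<^sub>M borel :: ('x \<times> 'u) measure)" by simp
  then show ?thesis
    unfolding borel_prod measurable_cong_sets[OF stationary_policyD(2)[OF \<gamma>] refl] .
qed

text \<open>This is the measure \<pi>(dx) \<gamma>(du|x). Each inner measure is
  \<open>\<gamma> x\<close> carried to the fibre over \<open>x\<close>; writing the mixture as a
  bind makes a transition step a second bind with the kernel.\<close>

definition policy_joint ::
  "'x::topological_space measure \<Rightarrow> ('x \<Rightarrow> 'u::topological_space measure) \<Rightarrow> ('x \<times> 'u) measure" where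
  "policy_joint \<pi> \<gamma> = \<pi> \<bind> (\<lambda>x. distr (\<gamma> x) borel (Pair x))"

context
  fixes \<gamma> :: "'x::second_countable_topology \<Rightarrow> 'u::second_countable_topology measure"
    and \<pi> :: "'x measure"
  assumes \<gamma>: "stationary_policy \<gamma>"
    and \<pi>: "prob_space \<pi>" "sets \<pi> = sets borel"
begin

lemma measurable_policy_joint_kernel:
  "(\<lambda>x. distr (\<gamma> x) borel (Pair x)) \<in> \<pi> \<rightarrow>\<^sub>M subprob_algebra borel"
proof -
  have "case_prod Pair \<in> (borel \<Otimes>\<^sub>M borel :: ('x \<times> 'u) measure) \<rightarrow>\<^sub>M borel"
    by (simp add: borel_prod)
  from measurable_distr2[OF this stationary_policyD(4)[OF \<gamma>]] show ?thesis
    using \<pi>(2) by (simp cong: measurable_cong_sets)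
qed

lemma space_state_measure: "space \<pi> = UNIV"
  using sets_eq_imp_space_eq[OF \<pi>(2)] by simp

lemma policy_joint_sets: "sets (policy_joint \<pi> \<gamma>) = sets borel"
  unfolding policy_joint_def using space_state_measure by (intro sets_bind) auto

lemma policy_joint_prob: "prob_space (policy_joint \<pi> \<gamma>)"
proof -
  interpret prob_space \<pi> by (rule \<pi>(1))
  show ?thesis
    unfolding policy_joint_def
    by (rule prob_space_bind[OF AE_I2 measurable_policy_joint_kernel])
      (rule prob_space.prob_space_distr[OF stationary_policyD(1)[OF \<gamma>] measurable_Pair_policy[OF \<gamma>]])
qed

lemma nn_integral_policy_joint:
  assumes g: "g \<in> borel_measurable borel"
  shows "(\<integral>\<^sup>+p. g p \<partial>policy_joint \<pi> \<gamma>) = (\<integral>\<^sup>+x. (\<integral>\<^sup>+u. g (x, u) \<partial>\<gamma> x) \<partial>\<pi>)"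
  unfolding policy_joint_def
  by (subst nn_integral_bind[OF g measurable_policy_joint_kernel])
    (simp add: nn_integral_distr[OF measurable_Pair_policy[OF \<gamma>]] g)

lemma nn_integral_policy_bounded:
  fixes g :: "'x \<times> 'u \<Rightarrow> real"
  assumes g: "g \<in> borel_measurable borel" "\<And>p. 0 \<le> g p" "\<And>p. g p \<le> 1"
  shows "(\<integral>\<^sup>+x. (\<integral>\<^sup>+u. ennreal (g (x, u)) \<partial>\<gamma> x) \<partial>\<pi>) = ennreal (\<integral>x. (\<integral>u. g (x, u) \<partial>\<gamma> x) \<partial>\<pi>)"
proof -
  interpret prob_space \<pi> by (rule \<pi>(1))
  have gm: "g \<in> borel_measurable (borel \<Otimes>\<^sub>M borel)" using g(1) by (simp add: borel_prod)
  have inner: "(\<integral>\<^sup>+u. ennreal (g (x, u)) \<partial>\<gamma> x) = ennreal (\<integral>u. g (x, u) \<partial>\<gamma> x)" for x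
  proof -
    interpret c: prob_space "\<gamma> x" by (rule stationary_policyD(1)[OF \<gamma>])
    have "integrable (\<gamma> x) (\<lambda>u. g (x, u))"
      using g measurable_compose[OF measurable_Pair_policy[OF \<gamma>] g(1)]
      by (intro c.integrable_const_bound[of _ 1] AE_I2) simp_all
    then show ?thesis using g(2) by (intro nn_integral_eq_integral) simp_all
  qed
  have b: "\<bar>\<integral>u. g (x, u) \<partial>\<gamma> x\<bar> \<le> 1" for x
    using g by (intro prob_space.abs_integral_le_bound stationary_policyD(1)[OF \<gamma>]) simp
  have "integrable \<pi> (\<lambda>x. \<integral>u. g (x, u) \<partial>\<gamma> x)"
    using b measurable_kernel_integral[OF stationary_policyD(4)[OF \<gamma>] gm] \<pi>(2)
    by (intro integrable_const_bound[of _ 1] AE_I2) (simp_all cong: measurable_cong_sets)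
  then show ?thesis
    unfolding inner using g(2) by (intro nn_integral_eq_integral AE_I2) (auto intro!: integral_nonneg_AE)
qed

context
  fixes T :: "'x \<Rightarrow> 'u \<Rightarrow> 'x measure"
  assumes T: "markov_kernel T"
begin

lemma kernel_measurable_joint: "(\<lambda>p. T (fst p) (snd p)) \<in> policy_joint \<pi> \<gamma> \<rightarrow>\<^sub>M subprob_algebra borel"
  using kernel_measurable_borel[OF T] unfolding measurable_cong_sets[OF policy_joint_sets refl] .

lemma joint_bind_kernel:
  shows "prob_space (policy_joint \<pi> \<gamma> \<bind> (\<lambda>p. T (fst p) (snd p)))"
    and "sets (policy_joint \<pi> \<gamma> \<bind> (\<lambda>p. T (fst p) (snd p))) = sets borel"
proof -
  interpret J: prob_space "policy_joint \<pi> \<gamma>" by (rule policy_joint_prob)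
  show "prob_space (policy_joint \<pi> \<gamma> \<bind> (\<lambda>p. T (fst p) (snd p)))"
    using T by (intro J.prob_space_bind[OF AE_I2 kernel_measurable_joint]) (simp add: markov_kernel_def)
  show "sets (policy_joint \<pi> \<gamma> \<bind> (\<lambda>p. T (fst p) (snd p))) = sets borel"
    using T J.not_empty by (intro sets_bind) (auto simp: markov_kernel_def)
qed

text \<open>Invariance as a fixed-point equation between measures, which can be checked on
  continuous test functions instead of on Borel sets.\<close>

lemma invariant_prob_iff: "invariant_prob T \<gamma> \<pi> \<longleftrightarrow> \<pi> = policy_joint \<pi> \<gamma> \<bind> (\<lambda>p. T (fst p) (snd p))"
proof -
  let ?N = "policy_joint \<pi> \<gamma> \<bind> (\<lambda>p. T (fst p) (snd p))"
  interpret J: prob_space "policy_joint \<pi> \<gamma>" by (rule policy_joint_prob)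
  have eq: "emeasure ?N A = (\<integral>\<^sup>+x. (\<integral>\<^sup>+u. emeasure (T x u) A \<partial>\<gamma> x) \<partial>\<pi>)" if A: "A \<in> sets borel" for A
  proof -
    have "emeasure ?N A = (\<integral>\<^sup>+p. emeasure (T (fst p) (snd p)) A \<partial>policy_joint \<pi> \<gamma>)"
      by (rule emeasure_bind[OF J.not_empty kernel_measurable_joint A])
    also have "\<dots> = (\<integral>\<^sup>+x. (\<integral>\<^sup>+u. emeasure (T x u) A \<partial>\<gamma> x) \<partial>\<pi>)"
      using measurable_emeasure_kernel[OF kernel_measurable_borel[OF T] A] by (simp add: nn_integral_policy_joint)
    finally show ?thesis .
  qed
  show ?thesis
  proof
    assume "invariant_prob T \<gamma> \<pi>"
    then show "\<pi> = ?N"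
      by (intro measure_eqI) (auto simp: joint_bind_kernel(2) \<pi>(2) invariant_prob_def eq)
  next
    assume N: "\<pi> = ?N"
    then have "emeasure \<pi> A = (\<integral>\<^sup>+x. (\<integral>\<^sup>+u. emeasure (T x u) A \<partial>\<gamma> x) \<partial>\<pi>)" if "A \<in> sets borel" for A
      using eq[OF that] by simp
    then show "invariant_prob T \<gamma> \<pi>"
      unfolding invariant_prob_def using \<pi> by blast
  qed
qed

text \<open>Integration against a bind is unfolded in \<open>ennreal\<close>, where it needs no
  integrability; the bounds 0 and 1 allow the return to real integrals at every level.\<close>

lemma integral_joint_bind_kernel:
  fixes c :: "'x \<Rightarrow> real"
  assumes c: "c \<in> borel_measurable borel" "\<And>x. 0 \<le> c x" "\<And>x. c x \<le> 1"
  shows "(\<integral>z. c z \<partial>(policy_joint \<pi> \<gamma> \<bind> (\<lambda>p. T (fst p) (snd p)))) =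
           (\<integral>x. (\<integral>u. (\<integral>z. c z \<partial>T x u) \<partial>\<gamma> x) \<partial>\<pi>)"
proof -
  let ?N = "policy_joint \<pi> \<gamma> \<bind> (\<lambda>p. T (fst p) (snd p))"
  interpret N: prob_space ?N by (rule joint_bind_kernel)
  let ?g = "\<lambda>p. \<integral>z. c z \<partial>T (fst p) (snd p)"
  have cN: "c \<in> borel_measurable ?N"
    using c(1) unfolding measurable_cong_sets[OF joint_bind_kernel(2) refl] .
  then have "integrable ?N c"
    using c by (intro N.integrable_const_bound[of _ 1] AE_I2) simp_all
  then have "ennreal (\<integral>z. c z \<partial>?N) = (\<integral>\<^sup>+z. ennreal (c z) \<partial>?N)"
    using c by (intro nn_integral_eq_integral[symmetric]) simp_all
  also have "\<dots> = (\<integral>\<^sup>+p. (\<integral>\<^sup>+z. ennreal (c z) \<partial>T (fst p) (snd p)) \<partial>policy_joint \<pi> \<gamma>)"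
    using c(1) by (intro nn_integral_bind[OF _ kernel_measurable_joint]) simp
  also have "\<dots> = (\<integral>\<^sup>+p. ennreal (?g p) \<partial>policy_joint \<pi> \<gamma>)"
    by (simp add: kernel_integral_bounded(4)[OF T c])
  also have "\<dots> = (\<integral>\<^sup>+x. (\<integral>\<^sup>+u. ennreal (?g (x, u)) \<partial>\<gamma> x) \<partial>\<pi>)"
    using kernel_integral_bounded(1)[OF T c] by (intro nn_integral_policy_joint) simp
  also have "\<dots> = ennreal (\<integral>x. (\<integral>u. ?g (x, u) \<partial>\<gamma> x) \<partial>\<pi>)"
    by (rule nn_integral_policy_bounded) (use kernel_integral_bounded[OF T c] in simp_all)
  finally show ?thesis
    using c kernel_integral_bounded(2)[OF T c] by (simp add: integral_nonneg_AE)
qed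

end

end

text \<open>A mixture of measures with densities has the mixed density, by Tonelli. Joint
  measurability of \<open>F\<close> is what permits the exchange of integrals.\<close>

lemma bind_eq_density:
  fixes \<psi> :: "'a::{metric_space, second_countable_topology} measure" and F :: "'p \<times> 'a \<Rightarrow> real"
  assumes \<psi>: "finite_measure \<psi>" "sets \<psi> = sets borel"
    and J: "prob_space J" and K: "K \<in> J \<rightarrow>\<^sub>M subprob_algebra borel"
    and F: "F \<in> borel_measurable (J \<Otimes>\<^sub>M borel)" "\<And>q. 0 \<le> F q" "\<And>q. F q \<le> M"
    and dens: "\<And>p. K p = density \<psi> (\<lambda>y. ennreal (F (p, y)))"
  shows "(\<lambda>y. \<integral>p. F (p, y) \<partial>J) \<in> borel_measurable borel"
    and "J \<bind> K = density \<psi> (\<lambda>y. ennreal (\<integral>p. F (p, y) \<partial>J))"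
proof -
  interpret J: prob_space J by (rule J)
  interpret \<psi>: finite_measure \<psi> by (rule \<psi>)
  interpret pair_sigma_finite J \<psi> ..
  have "(\<lambda>(y, p). F (p, y)) \<in> borel_measurable (borel \<Otimes>\<^sub>M J)"
    using measurable_pair_swap[OF F(1)] by simp
  then show hm: "(\<lambda>y. \<integral>p. F (p, y) \<partial>J) \<in> borel_measurable borel"
    by (rule J.borel_measurable_lebesgue_integral)
  then have hm': "(\<lambda>y. \<integral>p. F (p, y) \<partial>J) \<in> borel_measurable \<psi>"
    unfolding measurable_cong_sets[OF \<psi>(2) refl] .
  have F\<psi>: "F \<in> borel_measurable (J \<Otimes>\<^sub>M \<psi>)"
    using F(1) \<psi>(2) by (simp cong: measurable_cong_sets sets_pair_measure_cong)
  have Fy: "(\<lambda>p. F (p, y)) \<in> borel_measurable J" for y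
    by (rule measurable_compose[OF _ F(1)]) simp
  have Fp: "(\<lambda>y. F (p, y)) \<in> borel_measurable \<psi>" if "p \<in> space J" for p
    by (rule measurable_compose[OF _ F\<psi>]) (use that in simp)
  have inner: "(\<integral>\<^sup>+p. ennreal (F (p, y)) \<partial>J) = ennreal (\<integral>p. F (p, y) \<partial>J)" for y
    using F(2,3) Fy[of y] by (intro nn_integral_eq_integral J.integrable_const_bound[of _ M] AE_I2) simp_all
  show "J \<bind> K = density \<psi> (\<lambda>y. ennreal (\<integral>p. F (p, y) \<partial>J))"
  proof (rule measure_eqI)
    show s: "sets (J \<bind> K) = sets (density \<psi> (\<lambda>y. ennreal (\<integral>p. F (p, y) \<partial>J)))"
      using sets_bind_measurable[OF K J.not_empty] \<psi>(2) by simp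
    fix A assume "A \<in> sets (J \<bind> K)"
    then have A: "A \<in> sets \<psi>" "A \<in> sets borel" using s \<psi>(2) by auto
    have "emeasure (J \<bind> K) A = (\<integral>\<^sup>+p. emeasure (K p) A \<partial>J)"
      by (rule emeasure_bind[OF J.not_empty K A(2)])
    also have "\<dots> = (\<integral>\<^sup>+p. (\<integral>\<^sup>+y. ennreal (F (p, y)) * indicator A y \<partial>\<psi>) \<partial>J)"
      unfolding dens using Fp A by (intro nn_integral_cong emeasure_density) simp_all
    also have "\<dots> = (\<integral>\<^sup>+y. (\<integral>\<^sup>+p. ennreal (F (p, y)) * indicator A y \<partial>J) \<partial>\<psi>)"
      using F\<psi> A by (intro Fubini'[symmetric]) simp
    also have "\<dots> = (\<integral>\<^sup>+y. ennreal (\<integral>p. F (p, y) \<partial>J) * indicator A y \<partial>\<psi>)"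
      using Fy by (intro nn_integral_cong) (simp add: nn_integral_multc inner)
    also have "\<dots> = emeasure (density \<psi> (\<lambda>y. ennreal (\<integral>p. F (p, y) \<partial>J))) A"
      using hm' A by (intro emeasure_density[symmetric]) simp_all
    finally show "emeasure (J \<bind> K) A = emeasure (density \<psi> (\<lambda>y. ennreal (\<integral>p. F (p, y) \<partial>J))) A" .
  qed
qed

section \<open>Continuity of the invariant measure\<close>

text \<open>If convergence fails, infinitely many terms stay a fixed distance away from
  \<open>l\<close>; enumerating them gives a subsequence without any further subsequence tending to
  \<open>l\<close>.\<close>

lemma LIMSEQ_from_subsequences:
  fixes X :: "nat \<Rightarrow> 'a::metric_space"
  assumes "\<And>s :: nat \<Rightarrow> nat. strict_mono s \<Longrightarrow> \<exists>r :: nat \<Rightarrow> nat. strict_mono r \<and> (\<lambda>k. X (s (r k))) \<longlonglongrightarrow> l"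
  shows "X \<longlonglongrightarrow> l"
proof (rule ccontr)
  assume "\<not> X \<longlonglongrightarrow> l"
  then obtain e where e: "0 < e" "\<And>N. \<exists>n\<ge>N. \<not> dist (X n) l < e"
    unfolding lim_sequentially by blast
  then have "infinite {n. \<not> dist (X n) l < e}"
    unfolding infinite_nat_iff_unbounded_le by auto
  then obtain s :: "nat \<Rightarrow> nat" where s: "strict_mono s" "\<And>n. s n \<in> {n. \<not> dist (X n) l < e}"
    using infinite_enumerate by blast
  from assms[OF s(1)] obtain r :: "nat \<Rightarrow> nat" where "(\<lambda>k. X (s (r k))) \<longlonglongrightarrow> l" by blast
  then obtain k where "dist (X (s (r k))) l < e"
    using e(1) unfolding lim_sequentially by blast
  then show False using s(2)[of "r k"] by simp
qed

text \<open>The bound depends on \<open>w\<close> through \<open>C\<close> alone. With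
  \<open>w\<close> an indicator it controls total variation, with \<open>w\<close> continuous it
  controls weak convergence, and it also covers test functions that change with the policy.\<close>

lemma integral_density_diff_le:
  fixes w h h' :: "'a \<Rightarrow> real"
  assumes \<psi>: "finite_measure \<psi>"
    and w: "w \<in> borel_measurable \<psi>" "\<And>x. \<bar>w x\<bar> \<le> C"
    and h: "h \<in> borel_measurable \<psi>" "\<And>x. 0 \<le> h x" "\<And>x. h x \<le> M"
    and h': "h' \<in> borel_measurable \<psi>" "\<And>x. 0 \<le> h' x" "\<And>x. h' x \<le> M"
  shows "\<bar>(\<integral>x. w x \<partial>density \<psi> (\<lambda>y. ennreal (h y))) - (\<integral>x. w x \<partial>density \<psi> (\<lambda>y. ennreal (h' y)))\<bar>
           \<le> C * (\<integral>x. \<bar>h x - h' x\<bar> \<partial>\<psi>)"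
proof -
  interpret finite_measure \<psi> by (rule \<psi>)
  have hi: "integrable \<psi> h" "integrable \<psi> h'"
    using h h' by (intro integrable_const_bound[of _ M] AE_I2; simp)+
  have "(\<integral>x. w x \<partial>density \<psi> (\<lambda>y. ennreal (h y))) - (\<integral>x. w x \<partial>density \<psi> (\<lambda>y. ennreal (h' y)))
      = (\<integral>x. h x * w x \<partial>\<psi>) - (\<integral>x. h' x * w x \<partial>\<psi>)"
    using w h h' by (simp add: integral_density)
  also have "\<dots> = (\<integral>x. (h x - h' x) * w x \<partial>\<psi>)"
    using integrable_mult_bounded[OF hi(1) w] integrable_mult_bounded[OF hi(2) w]
    by (simp add: left_diff_distrib)
  also have "\<bar>\<dots>\<bar> \<le> (\<integral>x. \<bar>(h x - h' x) * w x\<bar> \<partial>\<psi>)" by (rule integral_abs_bound)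
  also have "\<dots> \<le> (\<integral>x. C * \<bar>h x - h' x\<bar> \<partial>\<psi>)"
  proof (rule integral_mono)
    show "integrable \<psi> (\<lambda>x. \<bar>(h x - h' x) * w x\<bar>)"
      using integrable_mult_bounded[OF Bochner_Integration.integrable_diff[OF hi] w] by (rule integrable_abs)
    show "integrable \<psi> (\<lambda>x. C * \<bar>h x - h' x\<bar>)" using hi by simp
    show "\<bar>(h x - h' x) * w x\<bar> \<le> C * \<bar>h x - h' x\<bar>" for x
      using mult_right_mono[OF w(2)[of x], of "\<bar>h x - h' x\<bar>"] by (simp add: abs_mult mult.commute)
  qed
  finally show ?thesis by simp
qed

theorem theorem4p1:
  fixes T :: "real^'n \<Rightarrow> 'u::{metric_space, second_countable_topology} \<Rightarrow> (real^'n) measure"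
    and \<psi> :: "(real^'n) measure"
    and f :: "real^'n \<Rightarrow> 'u \<Rightarrow> real^'n \<Rightarrow> real"
    and \<pi> :: "(real^'n \<Rightarrow> 'u measure) \<Rightarrow> (real^'n) measure"
  assumes U_compact: "compact (UNIV :: 'u set)"
    and kernel: "markov_kernel T"
    and inv: "\<And>\<gamma>. stationary_policy \<gamma> \<Longrightarrow>
                 invariant_prob T \<gamma> (\<pi> \<gamma>) \<and> (\<forall>\<mu>. invariant_prob T \<gamma> \<mu> \<longrightarrow> \<mu> = \<pi> \<gamma>)"
    and psi: "finite_measure \<psi>" "sets \<psi> = sets borel"
    and dens: "\<And>x u. f x u \<in> borel_measurable borel \<and> (\<forall>y. f x u y \<ge> 0) \<and>
                       T x u = density \<psi> (\<lambda>y. ennreal (f x u y))"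
    and bdd: "\<exists>M. \<forall>x u y. \<bar>f x u y\<bar> \<le> M"
    and equicont: "\<forall>y. \<forall>e>0. \<exists>d>0. \<forall>x u y'. dist y' y < d \<longrightarrow> \<bar>f x u y' - f x u y\<bar> < e"
    and iii:
      "((\<forall>h :: real^'n \<Rightarrow> real. continuous_on UNIV h \<and> bounded (range h) \<longrightarrow>
            continuous_on UNIV (\<lambda>(x, u). \<integral>z. h z \<partial>T x u))
         \<and> weakly_compact_meas (occupation_measures T))
       \<or>
       ((\<forall>x. \<forall>h :: real^'n \<Rightarrow> real. h \<in> borel_measurable borel \<and> bounded (range h) \<longrightarrow>
            continuous_on UNIV (\<lambda>u. \<integral>z. h z \<partial>T x u))
         \<and> (\<exists>\<nu>. finite_measure \<nu> \<and> sets \<nu> = sets borel \<and>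
              (\<forall>x u. \<forall>A\<in>sets borel. emeasure (T x u) A \<le> emeasure \<nu> A)))"
  shows "\<forall>\<gamma>s \<gamma>. (\<forall>k. stationary_policy (\<gamma>s k)) \<longrightarrow> stationary_policy \<gamma> \<longrightarrow>
            young_conv \<psi> \<gamma>s \<gamma> \<longrightarrow>
            weak_conv_meas (\<lambda>k. \<pi> (\<gamma>s k)) (\<pi> \<gamma>) \<and> tv_conv_meas (\<lambda>k. \<pi> (\<gamma>s k)) (\<pi> \<gamma>)"
proof (intro allI impI)
  fix \<gamma>s :: "nat \<Rightarrow> real^'n \<Rightarrow> 'u measure" and \<gamma> :: "real^'n \<Rightarrow> 'u measure"
  assume "\<forall>k. stationary_policy (\<gamma>s k)" and \<gamma>: "stationary_policy \<gamma>" and conv: "young_conv \<psi> \<gamma>s \<gamma>"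
  then have \<gamma>s: "stationary_policy (\<gamma>s k)" for k by blast
  interpret \<psi>: finite_measure \<psi> by (rule psi(1))
  note to_psi = measurable_cong_sets[OF psi(2) refl]
  obtain M where M: "\<And>x u y. \<bar>f x u y\<bar> \<le> M" using bdd by blast
  obtain S where S: "closed S" "emeasure \<psi> (- S) = 0" "\<And>y r. y \<in> S \<Longrightarrow> 0 < r \<Longrightarrow> emeasure \<psi> (ball y r) \<noteq> 0"
    using support_exists[OF psi(2)] by blast
  let ?K = "\<lambda>p. T (fst p) (snd p)"
  define F where "F q = indicator S (snd q) * f (fst (fst q)) (snd (fst q)) (snd q)" for q
  have f_le: "f x u y \<le> M" for x u y using M[of x u y] by linarith
  have K: "?K \<in> borel \<rightarrow>\<^sub>M subprob_algebra borel"
    using kernel by (rule kernel_measurable_borel)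
  have equi: "\<exists>d>0. \<forall>p y'. dist y' y < d \<longrightarrow> \<bar>f (fst p) (snd p) y' - f (fst p) (snd p) y\<bar> < e" if "0 < e" for y e
    using equicont that by meson
  have F: "F \<in> borel_measurable (borel \<Otimes>\<^sub>M borel)" "?K p = density \<psi> (\<lambda>y. ennreal (F (p, y)))" for p
  proof -
    note * = kernel_jointly_measurable_density[OF psi K, where f="\<lambda>p. f (fst p) (snd p)", OF _ _ f_le _ equi S]
    show "F \<in> borel_measurable (borel \<Otimes>\<^sub>M borel)"
      unfolding F_def[abs_def] by (rule *(1)) (use dens in auto)
    show "?K p = density \<psi> (\<lambda>y. ennreal (F (p, y)))"
      unfolding F_def fst_conv snd_conv by (rule *(2)) (use dens in auto)
  qed
  have M0: "0 \<le> M" using M[of undefined undefined undefined] by linarith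
  have F_bounds: "0 \<le> F q" "F q \<le> M" for q
    using dens f_le M0 by (auto simp: F_def indicator_def)

  \<comment> \<open>This picks a version of the invariant density defined at every point, not just
    up to null sets, so that pointwise bounds and equicontinuity make sense for it.\<close>
  define h where "h \<delta> y = (\<integral>p. F (p, y) \<partial>policy_joint (\<pi> \<delta>) \<delta>)" for \<delta> y
  have inv_pi: "prob_space (\<pi> \<delta>)" "sets (\<pi> \<delta>) = sets borel" "invariant_prob T \<delta> (\<pi> \<delta>)"
    if "stationary_policy \<delta>" for \<delta>
    using inv[OF that] by (auto simp: invariant_prob_def)
  have h: "h \<delta> \<in> borel_measurable \<psi>" "\<pi> \<delta> = density \<psi> (\<lambda>y. ennreal (h \<delta> y))"
      "0 \<le> h \<delta> y" "h \<delta> y \<le> M" "y \<notin> S \<Longrightarrow> h \<delta> y = 0"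
    if \<delta>: "stationary_policy \<delta>" for \<delta> y
  proof -
    note \<pi> = inv_pi(1,2)[OF \<delta>]
    let ?J = "policy_joint (\<pi> \<delta>) \<delta>"
    interpret J: prob_space ?J by (rule policy_joint_prob[OF \<delta> \<pi>])
    have FJ: "F \<in> borel_measurable (?J \<Otimes>\<^sub>M borel)"
      using F(1) policy_joint_sets[OF \<delta> \<pi>] by (simp cong: measurable_cong_sets sets_pair_measure_cong)
    note bind = bind_eq_density[OF psi J.prob_space_axioms kernel_measurable_joint[OF \<delta> \<pi> kernel] FJ F_bounds F(2)]
    show "h \<delta> \<in> borel_measurable \<psi>"
      using bind(1) unfolding to_psi h_def[abs_def] .
    show "\<pi> \<delta> = density \<psi> (\<lambda>y. ennreal (h \<delta> y))"
      using bind(2) inv_pi(3)[OF \<delta>] unfolding invariant_prob_iff[OF \<delta> \<pi> kernel] h_def by simp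
    show "0 \<le> h \<delta> y" unfolding h_def using F_bounds(1) by simp
    have "\<bar>h \<delta> y\<bar> \<le> M" unfolding h_def using F_bounds by (intro J.abs_integral_le_bound) simp
    then show "h \<delta> y \<le> M" by simp
    show "h \<delta> y = 0" if "y \<notin> S" using that by (simp add: h_def F_def)
  qed
  \<comment> \<open>The modulus of the \<open>f x u\<close> is uniform in \<open>(x, u)\<close>, and
    averaging against a probability measure preserves it; hence one \<open>d\<close> serves all
    policies.\<close>
  have h_equi: "\<exists>d>0. \<forall>\<delta>. stationary_policy \<delta> \<longrightarrow> (\<forall>y'\<in>S. dist y' y < d \<longrightarrow> \<bar>h \<delta> y' - h \<delta> y\<bar> \<le> e)"
    if y: "y \<in> S" and e: "0 < e" for y e
  proof -
    obtain d where d: "0 < d" "\<And>x u y'. dist y' y < d \<Longrightarrow> \<bar>f x u y' - f x u y\<bar> < e"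
      using equicont e by meson
    have "\<bar>h \<delta> y' - h \<delta> y\<bar> \<le> e" if \<delta>: "stationary_policy \<delta>" and y': "y' \<in> S" "dist y' y < d" for \<delta> y'
    proof -
      note \<pi> = inv_pi(1,2)[OF \<delta>]
      interpret J: prob_space "policy_joint (\<pi> \<delta>) \<delta>" by (rule policy_joint_prob[OF \<delta> \<pi>])
      have int: "integrable (policy_joint (\<pi> \<delta>) \<delta>) (\<lambda>p. F (p, z))" for z
      proof (rule J.integrable_const_bound[of _ M, OF AE_I2])
        show "norm (F (p, z)) \<le> M" for p using F_bounds[of "(p, z)"] by simp
        have "(\<lambda>p. F (p, z)) \<in> borel_measurable borel" by (rule measurable_compose[OF _ F(1)]) simp
        then show "(\<lambda>p. F (p, z)) \<in> borel_measurable (policy_joint (\<pi> \<delta>) \<delta>)"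
          unfolding measurable_cong_sets[OF policy_joint_sets[OF \<delta> \<pi>] refl] .
      qed
      have "h \<delta> y' - h \<delta> y = (\<integral>p. F (p, y') - F (p, y) \<partial>policy_joint (\<pi> \<delta>) \<delta>)"
        unfolding h_def using int by simp
      also have "\<bar>\<dots>\<bar> \<le> e"
        using y y'(1) d(2)[OF y'(2)] by (intro J.abs_integral_le_bound) (simp add: F_def less_imp_le)
      finally show ?thesis .
    qed
    then show ?thesis using d(1) by blast
  qed

  have L1: "(\<lambda>n. \<integral>y. \<bar>h (\<gamma>s n) y - h \<gamma> y\<bar> \<partial>\<psi>) \<longlonglongrightarrow> 0"
  proof (rule LIMSEQ_from_subsequences)
    fix s :: "nat \<Rightarrow> nat" assume s: "strict_mono s"
    have "\<exists>r :: nat \<Rightarrow> nat. strict_mono r \<and> (\<forall>y\<in>S. convergent (\<lambda>k. h (\<gamma>s (s (r k))) y))"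
    proof (rule equicontinuous_pointwise_convergent_subsequence)
      show "\<bar>h (\<gamma>s (s n)) y\<bar> \<le> M" for n y using h(3,4)[OF \<gamma>s, of "s n" y] by simp
      show "\<exists>d>0. \<forall>n. \<forall>y'\<in>S. dist y' y < d \<longrightarrow> \<bar>h (\<gamma>s (s n)) y' - h (\<gamma>s (s n)) y\<bar> \<le> e"
        if "y \<in> S" "0 < e" for y e
        using h_equi[OF that] \<gamma>s by blast
    qed
    then obtain r :: "nat \<Rightarrow> nat" where r: "strict_mono r" "\<And>y. y \<in> S \<Longrightarrow> convergent (\<lambda>k. h (\<gamma>s (s (r k))) y)"
      by blast
    define \<sigma> where "\<sigma> k = \<gamma>s (s (r k))" for k
    have \<sigma>: "stationary_policy (\<sigma> k)" for k by (simp add: \<sigma>_def \<gamma>s)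
    have \<sigma>_conv: "young_conv \<psi> \<sigma> \<gamma>"
      using conv LIMSEQ_subseq_LIMSEQ[OF _ strict_mono_o[OF s r(1)]]
      unfolding young_conv_def \<sigma>_def o_def by blast
    \<comment> \<open>The limit exists at every point: on \<open>S\<close> by the choice of the
      subsequence, elsewhere because all the densities vanish.\<close>
    define hl where "hl y = lim (\<lambda>k. h (\<sigma> k) y)" for y
    have hl_lim: "(\<lambda>k. h (\<sigma> k) y) \<longlonglongrightarrow> hl y" for y
    proof -
      have "convergent (\<lambda>k. h (\<sigma> k) y)"
      proof (cases "y \<in> S")
        case True
        then show ?thesis unfolding \<sigma>_def by (rule r(2))
      next
        case False
        then show ?thesis using h(5)[OF \<sigma>] by (simp add: convergent_const)
      qed
      then show ?thesis unfolding hl_def by (simp add: convergent_LIMSEQ_iff)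
    qed
    have hl: "hl \<in> borel_measurable \<psi>" "0 \<le> hl y" "hl y \<le> M" for y
    proof -
      show "hl \<in> borel_measurable \<psi>" by (rule borel_measurable_LIMSEQ_real[OF hl_lim h(1)[OF \<sigma>]])
      show "0 \<le> hl y" by (rule LIMSEQ_le_const[OF hl_lim]) (use h(3)[OF \<sigma>] in auto)
      show "hl y \<le> M" by (rule LIMSEQ_le_const2[OF hl_lim]) (use h(4)[OF \<sigma>] in auto)
    qed
    have int: "integrable \<psi> (h (\<sigma> k))" "integrable \<psi> hl" for k
      using h[OF \<sigma>] hl by (intro \<psi>.integrable_const_bound[of _ M] AE_I2; simp)+
    have hl_L1: "(\<lambda>k. \<integral>y. \<bar>h (\<sigma> k) y - hl y\<bar> \<partial>\<psi>) \<longlonglongrightarrow> 0"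
    proof -
      have "(\<lambda>k. \<integral>y. \<bar>h (\<sigma> k) y - hl y\<bar> \<partial>\<psi>) \<longlonglongrightarrow> (\<integral>y. 0 \<partial>\<psi>)"
      proof (rule integral_dominated_convergence[where w="\<lambda>_. M"])
        show "AE y in \<psi>. (\<lambda>k. \<bar>h (\<sigma> k) y - hl y\<bar>) \<longlonglongrightarrow> 0"
          by (rule AE_I2, rule tendsto_rabs_zero, rule LIM_zero[OF hl_lim])
        \<comment> \<open>Both values lie in \<open>[0, M]\<close>, so their distance is at most
          \<open>M\<close>; since \<psi> is finite, the constant is an integrable majorant.\<close>
        have "norm \<bar>h (\<sigma> k) y - hl y\<bar> \<le> M" for k y
          using h(3,4)[OF \<sigma>, of k y] hl(2,3)[of y] by (simp add: abs_le_iff)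
        then show "AE y in \<psi>. norm \<bar>h (\<sigma> k) y - hl y\<bar> \<le> M" for k by simp
      qed (use h(1)[OF \<sigma>] hl(1) in auto)
      then show ?thesis by simp
    qed
    define \<mu> where "\<mu> = density \<psi> (\<lambda>y. ennreal (hl y))"
    have sets_\<mu>: "sets \<mu> = sets borel" using psi(2) by (simp add: \<mu>_def)
    \<comment> \<open>The test functions may vary with \<open>k\<close>. This is the decoupling
      step: it will be used for the averages \<open>W (\<sigma> k)\<close>, which move together with
      the measures.\<close>
    have lim_\<mu>: "(\<lambda>k. (\<integral>x. w k x \<partial>\<pi> (\<sigma> k)) - (\<integral>x. w k x \<partial>\<mu>)) \<longlonglongrightarrow> 0"
      if w: "\<And>k. w k \<in> borel_measurable borel" "\<And>k x. \<bar>w k x\<bar> \<le> 1" for w :: "nat \<Rightarrow> real^'n \<Rightarrow> real"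
    proof (rule tendsto_rabs_zero_cancel, rule tendsto_sandwich[OF _ _ tendsto_const hl_L1])
      show "\<forall>\<^sub>F k in sequentially. \<bar>(\<integral>x. w k x \<partial>\<pi> (\<sigma> k)) - (\<integral>x. w k x \<partial>\<mu>)\<bar> \<le> (\<integral>y. \<bar>h (\<sigma> k) y - hl y\<bar> \<partial>\<psi>)"
      proof (rule always_eventually, rule allI)
        fix k
        have "w k \<in> borel_measurable \<psi>" using w(1) unfolding to_psi .
        from integral_density_diff_le[OF psi(1) this w(2) h(1,3,4)[OF \<sigma>] hl]
        show "\<bar>(\<integral>x. w k x \<partial>\<pi> (\<sigma> k)) - (\<integral>x. w k x \<partial>\<mu>)\<bar> \<le> (\<integral>y. \<bar>h (\<sigma> k) y - hl y\<bar> \<partial>\<psi>)"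
          unfolding \<mu>_def h(2)[OF \<sigma>, symmetric] by simp
      qed
    qed simp
    \<comment> \<open>The constant test function 1 carries the total mass to the limit: convergence
      in L^1 rules out escape of mass.\<close>
    have prob_\<mu>: "prob_space \<mu>"
    proof -
      have fin: "emeasure \<mu> (space \<mu>) = ennreal (\<integral>y. hl y \<partial>\<psi>)"
      proof -
        have "emeasure \<mu> (space \<mu>) = (\<integral>\<^sup>+y. ennreal (hl y) \<partial>\<psi>)"
          unfolding \<mu>_def using hl(1) by (simp add: emeasure_density cong: nn_integral_cong)
        also have "\<dots> = ennreal (\<integral>y. hl y \<partial>\<psi>)"
          using int(2) hl(2) by (intro nn_integral_eq_integral) auto
        finally show ?thesis .
      qed
      have "finite_measure \<mu>" by (rule finite_measureI) (simp add: fin)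
      then interpret \<mu>: finite_measure \<mu> .
      have "(\<integral>x. 1 \<partial>\<pi> (\<sigma> k)) = (1::real)" for k
        using prob_space.prob_space[OF inv_pi(1)[OF \<sigma>[of k]]] by simp
      then have "(\<lambda>k. 1 - (\<integral>x. 1 \<partial>\<mu>)) \<longlonglongrightarrow> (0::real)"
        using lim_\<mu>[of "\<lambda>_ _. 1"] by simp
      then have "measure \<mu> (space \<mu>) = 1" by (simp add: LIMSEQ_const_iff)
      then show ?thesis by (intro prob_spaceI) (simp add: \<mu>.emeasure_eq_measure)
    qed
    have "\<mu> = policy_joint \<mu> \<gamma> \<bind> ?K"
    proof (rule finite_measure_eqI_continuous)
      show "finite_measure \<mu>" using prob_\<mu> by (rule prob_space.finite_measure)
      show "sets \<mu> = sets borel" by (rule sets_\<mu>)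
      show "finite_measure (policy_joint \<mu> \<gamma> \<bind> ?K)"
        by (rule prob_space.finite_measure[OF joint_bind_kernel(1)[OF \<gamma> prob_\<mu> sets_\<mu> kernel]])
      show "sets (policy_joint \<mu> \<gamma> \<bind> ?K) = sets borel"
        by (rule joint_bind_kernel(2)[OF \<gamma> prob_\<mu> sets_\<mu> kernel])
      fix c :: "real^'n \<Rightarrow> real"
      assume c: "continuous_on UNIV c" "\<And>x. 0 \<le> c x \<and> c x \<le> 1"
      have cm: "c \<in> borel_measurable borel" by (rule borel_measurable_continuous_onI[OF c(1)])
      have c01: "0 \<le> c x" "c x \<le> 1" for x using c(2) by auto
      define g where "g p = (\<integral>z. c z \<partial>?K p)" for p
      have g: "g \<in> borel_measurable borel" "0 \<le> g p" "g p \<le> 1" for p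
        unfolding g_def[abs_def]
        by (rule kernel_integral_bounded[OF kernel cm c01])+
      have bc: "bounded (range c)" using c01 by (auto simp: bounded_iff intro!: exI[of _ 1])
      \<comment> \<open>Under (a), joint continuity is restricted to the slice at \<open>x\<close>;
        under (b), \<open>c\<close> serves as a bounded Borel test function.\<close>
      have gcont: "continuous_on UNIV (\<lambda>u. g (x, u))" for x
        using iii
      proof
        assume "(\<forall>h :: real^'n \<Rightarrow> real. continuous_on UNIV h \<and> bounded (range h) \<longrightarrow>
            continuous_on UNIV (\<lambda>(x, u). \<integral>z. h z \<partial>T x u)) \<and> weakly_compact_meas (occupation_measures T)"
        then have "continuous_on UNIV (\<lambda>(x, u). \<integral>z. c z \<partial>T x u)" using c(1) bc by blast
        then have "continuous_on UNIV g" by (simp add: g_def[abs_def] case_prod_unfold)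
        then show ?thesis by (rule continuous_on_compose2) (auto intro!: continuous_intros)
      next
        assume "(\<forall>x. \<forall>h :: real^'n \<Rightarrow> real. h \<in> borel_measurable borel \<and> bounded (range h) \<longrightarrow>
            continuous_on UNIV (\<lambda>u. \<integral>z. h z \<partial>T x u))
         \<and> (\<exists>\<nu>. finite_measure \<nu> \<and> sets \<nu> = sets borel \<and>
              (\<forall>x u. \<forall>A\<in>sets borel. emeasure (T x u) A \<le> emeasure \<nu> A))"
        then show ?thesis using cm bc by (simp add: g_def)
      qed
      define W where "W \<delta> x = (\<integral>u. g (x, u) \<partial>\<delta> x)" for \<delta> :: "real^'n \<Rightarrow> 'u measure" and x
      have W: "W \<delta> \<in> borel_measurable borel" "\<bar>W \<delta> x\<bar> \<le> 1" if "stationary_policy \<delta>" for \<delta> x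
      proof -
        show "W \<delta> \<in> borel_measurable borel"
          unfolding W_def[abs_def]
          using measurable_kernel_integral[OF stationary_policyD(4)[OF that]] g(1) by (simp add: borel_prod)
        show "\<bar>W \<delta> x\<bar> \<le> 1"
          unfolding W_def using g by (intro prob_space.abs_integral_le_bound stationary_policyD(1)[OF that]) simp
      qed
      have c_pi: "(\<integral>x. c x \<partial>\<pi> (\<sigma> k)) = (\<integral>x. W (\<sigma> k) x \<partial>\<pi> (\<sigma> k))" for k
      proof -
        note \<pi> = inv_pi(1,2)[OF \<sigma>[of k]]
        have "(\<integral>x. c x \<partial>\<pi> (\<sigma> k)) = (\<integral>x. c x \<partial>(policy_joint (\<pi> (\<sigma> k)) (\<sigma> k) \<bind> ?K))"
          using inv_pi(3)[OF \<sigma>[of k]] unfolding invariant_prob_iff[OF \<sigma> \<pi> kernel] by simp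
        also have "\<dots> = (\<integral>x. W (\<sigma> k) x \<partial>\<pi> (\<sigma> k))"
          unfolding integral_joint_bind_kernel[OF \<sigma> \<pi> kernel cm c01] W_def g_def by simp
        finally show ?thesis .
      qed
      \<comment> \<open>Moving the density into the integrand makes \<psi> the outer measure, as
        Young convergence at \<psi> demands. The price is an integrand known only to be measurable
        in \<open>x\<close>.\<close>
      have W_\<mu>: "(\<integral>x. W \<delta> x \<partial>\<mu>) = (\<integral>x. (\<integral>u. hl x * g (x, u) \<partial>\<delta> x) \<partial>\<psi>)" if "stationary_policy \<delta>" for \<delta>
      proof -
        have "W \<delta> \<in> borel_measurable \<psi>" using W(1)[OF that] unfolding to_psi .
        then have "(\<integral>x. W \<delta> x \<partial>\<mu>) = (\<integral>x. hl x * W \<delta> x \<partial>\<psi>)"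
          unfolding \<mu>_def using hl by (simp add: integral_density)
        then show ?thesis by (simp add: W_def)
      qed
      have "(\<lambda>k. \<integral>x. (\<integral>u. hl x * g (x, u) \<partial>\<sigma> k x) \<partial>\<psi>) \<longlonglongrightarrow> (\<integral>x. (\<integral>u. hl x * g (x, u) \<partial>\<gamma> x) \<partial>\<psi>)"
      proof -
        have "hl \<in> borel_measurable borel" using hl(1) unfolding to_psi .
        then have "(\<lambda>p. hl (fst p) * g p) \<in> borel_measurable (borel \<Otimes>\<^sub>M borel)"
          using g(1) unfolding borel_prod[symmetric] by (intro borel_measurable_times measurable_compose[OF measurable_fst])
        then have "(\<lambda>p. hl (fst p) * g p) \<in> borel_measurable borel" by (simp add: borel_prod)
        moreover have "\<bar>hl (fst p) * g p\<bar> \<le> M" for p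
          using mult_mono[OF hl(3)[of "fst p"] g(3)[of p] M0 g(2)[of p]] hl(2) g(2) by (simp add: abs_mult)
        moreover have "continuous_on UNIV (\<lambda>u. hl (fst (x, u)) * g (x, u))" for x
          using gcont[of x] by (auto intro!: continuous_intros)
        ultimately show ?thesis
          using young_conv_caratheodory[OF U_compact psi \<sigma> \<gamma> \<sigma>_conv, of "\<lambda>p. hl (fst p) * g p" M] by simp
      qed
      then have "(\<lambda>k. \<integral>x. W (\<sigma> k) x \<partial>\<mu>) \<longlonglongrightarrow> (\<integral>x. W \<gamma> x \<partial>\<mu>)"
        by (simp only: W_\<mu>[OF \<sigma>] W_\<mu>[OF \<gamma>])
      \<comment> \<open>First summand: the measure is replaced by \<mu> with the policy kept;
        second: the policy converges with \<mu> kept. By \<open>c_pi\<close> the sum is the integral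
        of \<open>c\<close> against the invariant measures.\<close>
      from tendsto_add[OF lim_\<mu>[of "\<lambda>k. W (\<sigma> k)", OF W[OF \<sigma>]] this]
      have "(\<lambda>k. \<integral>x. c x \<partial>\<pi> (\<sigma> k)) \<longlonglongrightarrow> (\<integral>x. W \<gamma> x \<partial>\<mu>)"
        by (simp add: c_pi)
      moreover have "(\<lambda>k. \<integral>x. c x \<partial>\<pi> (\<sigma> k)) \<longlonglongrightarrow> (\<integral>x. c x \<partial>\<mu>)"
        using lim_\<mu>[of "\<lambda>_. c"] cm c01 by (simp add: LIM_zero_iff)
      ultimately have "(\<integral>x. c x \<partial>\<mu>) = (\<integral>x. W \<gamma> x \<partial>\<mu>)" by (rule LIMSEQ_unique[rotated])
      also have "\<dots> = (\<integral>x. c x \<partial>(policy_joint \<mu> \<gamma> \<bind> ?K))"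
        unfolding integral_joint_bind_kernel[OF \<gamma> prob_\<mu> sets_\<mu> kernel cm c01] W_def g_def by simp
      finally show "(\<integral>x. c x \<partial>\<mu>) = (\<integral>x. c x \<partial>(policy_joint \<mu> \<gamma> \<bind> ?K))" .
    qed
    then have "invariant_prob T \<gamma> \<mu>"
      unfolding invariant_prob_iff[OF \<gamma> prob_\<mu> sets_\<mu> kernel] .
    then have "\<mu> = \<pi> \<gamma>" using inv[OF \<gamma>] by blast
    then have "density \<psi> (\<lambda>y. ennreal (hl y)) = density \<psi> (\<lambda>y. ennreal (h \<gamma> y))"
      unfolding \<mu>_def using h(2)[OF \<gamma>] by simp
    \<comment> \<open>Equal measures determine their densities almost everywhere, which is all that
      an L^1 distance sees.\<close>
    then have "AE y in \<psi>. ennreal (hl y) = ennreal (h \<gamma> y)"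
      using hl(1) h(1)[OF \<gamma>] by (intro \<psi>.density_unique) simp_all
    then have ae: "AE y in \<psi>. hl y = h \<gamma> y"
      using hl(2) h(3)[OF \<gamma>] by (auto elim!: AE_mp)
    have "(\<integral>y. \<bar>h (\<sigma> k) y - hl y\<bar> \<partial>\<psi>) = (\<integral>y. \<bar>h (\<sigma> k) y - h \<gamma> y\<bar> \<partial>\<psi>)" for k
      using ae hl(1) h(1)[OF \<sigma>] h(1)[OF \<gamma>] by (intro integral_cong_AE) (auto elim!: AE_mp)
    then have "(\<lambda>k. \<integral>y. \<bar>h (\<gamma>s (s (r k))) y - h \<gamma> y\<bar> \<partial>\<psi>) \<longlonglongrightarrow> 0"
      using hl_L1 by (simp add: \<sigma>_def)
    then show "\<exists>r. strict_mono r \<and> (\<lambda>k. \<integral>y. \<bar>h (\<gamma>s (s (r k))) y - h \<gamma> y\<bar> \<partial>\<psi>) \<longlonglongrightarrow> 0"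
      using r(1) by blast
  qed
  have diff_le: "\<bar>(\<integral>x. w x \<partial>\<pi> (\<gamma>s n)) - (\<integral>x. w x \<partial>\<pi> \<gamma>)\<bar> \<le> C * (\<integral>y. \<bar>h (\<gamma>s n) y - h \<gamma> y\<bar> \<partial>\<psi>)"
    if w: "w \<in> borel_measurable borel" "\<And>x. \<bar>w x\<bar> \<le> C" for w C n
  proof -
    have "w \<in> borel_measurable \<psi>" using w(1) unfolding to_psi .
    from integral_density_diff_le[OF psi(1) this w(2) h(1,3,4)[OF \<gamma>s] h(1,3,4)[OF \<gamma>]] show ?thesis
      unfolding h(2)[OF \<gamma>s, symmetric] h(2)[OF \<gamma>, symmetric] .
  qed
  have "weak_conv_meas (\<lambda>k. \<pi> (\<gamma>s k)) (\<pi> \<gamma>)"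
    unfolding weak_conv_meas_def
  proof (intro allI impI)
    fix g :: "real^'n \<Rightarrow> real" assume g: "continuous_on UNIV g \<and> bounded (range g)"
    then obtain C where C: "\<And>x. \<bar>g x\<bar> \<le> C" by (auto simp: bounded_iff)
    have gm: "g \<in> borel_measurable borel" using g by (intro borel_measurable_continuous_onI) simp
    have "(\<lambda>n. (\<integral>x. g x \<partial>\<pi> (\<gamma>s n)) - (\<integral>x. g x \<partial>\<pi> \<gamma>)) \<longlonglongrightarrow> 0"
    proof (rule tendsto_rabs_zero_cancel, rule tendsto_sandwich[OF _ _ tendsto_const])
      show "(\<lambda>n. C * (\<integral>y. \<bar>h (\<gamma>s n) y - h \<gamma> y\<bar> \<partial>\<psi>)) \<longlonglongrightarrow> 0"
        using tendsto_mult_left[OF L1, of C] by simp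
      show "\<forall>\<^sub>F n in sequentially. \<bar>(\<integral>x. g x \<partial>\<pi> (\<gamma>s n)) - (\<integral>x. g x \<partial>\<pi> \<gamma>)\<bar> \<le> C * (\<integral>y. \<bar>h (\<gamma>s n) y - h \<gamma> y\<bar> \<partial>\<psi>)"
        by (rule always_eventually, rule allI, rule diff_le[OF gm C])
    qed simp
    then show "(\<lambda>n. \<integral>x. g x \<partial>\<pi> (\<gamma>s n)) \<longlonglongrightarrow> (\<integral>x. g x \<partial>\<pi> \<gamma>)" by (rule LIM_zero_cancel)
  qed
  moreover have "tv_conv_meas (\<lambda>k. \<pi> (\<gamma>s k)) (\<pi> \<gamma>)"
    unfolding tv_conv_meas_def
  proof (rule tendsto_sandwich[OF _ _ tendsto_const L1])
    have A_le: "\<bar>measure (\<pi> (\<gamma>s n)) A - measure (\<pi> \<gamma>) A\<bar> \<le> (\<integral>y. \<bar>h (\<gamma>s n) y - h \<gamma> y\<bar> \<partial>\<psi>)"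
      if A: "A \<in> sets borel" for n A
    proof -
      have "(\<integral>x. indicator A x \<partial>\<pi> \<delta>) = measure (\<pi> \<delta>) A" if "stationary_policy \<delta>" for \<delta>
        using A inv_pi(2)[OF that] by (simp add: sets_eq_imp_space_eq)
      then show ?thesis
        using diff_le[of "indicator A" 1 n] A \<gamma>s \<gamma> by simp
    qed
    show "\<forall>\<^sub>F n in sequentially. (SUP A\<in>sets borel. \<bar>measure (\<pi> (\<gamma>s n)) A - measure (\<pi> \<gamma>) A\<bar>)
        \<le> (\<integral>y. \<bar>h (\<gamma>s n) y - h \<gamma> y\<bar> \<partial>\<psi>)"
      by (rule always_eventually, rule allI, rule cSUP_least) (use A_le in auto)
    \<comment> \<open>A real supremum dominates its members only when the family is bounded above;
      the estimate uniform in \<open>A\<close> supplies this, and the empty set contributes the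
      value 0.\<close>
    have "0 \<le> (SUP A\<in>sets borel. \<bar>measure (\<pi> (\<gamma>s n)) A - measure (\<pi> \<gamma>) A\<bar>)" for n
    proof -
      have "bdd_above ((\<lambda>A. \<bar>measure (\<pi> (\<gamma>s n)) A - measure (\<pi> \<gamma>) A\<bar>) ` sets borel)"
        using A_le by (rule bdd_aboveI2)
      from cSUP_upper[OF _ this, of "{}"] show ?thesis by simp
    qed
    then show "\<forall>\<^sub>F n in sequentially. 0 \<le> (SUP A\<in>sets borel. \<bar>measure (\<pi> (\<gamma>s n)) A - measure (\<pi> \<gamma>) A\<bar>)"
      by simp
  qed
  ultimately show "weak_conv_meas (\<lambda>k. \<pi> (\<gamma>s k)) (\<pi> \<gamma>) \<and> tv_conv_meas (\<lambda>k. \<pi> (\<gamma>s k)) (\<pi> \<gamma>)" ..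
qed

end
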